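(* Let $A > 0$ be arbitrary but fixed, and for each large prime $q$ set $H = H(q) = q/\log^{A} q$. Then there exists a choice, for each large prime $q$, of a non-real Dirichlet character $\chi = \chi_q$ modulo $q$ such that, with $X$ uniformly distributed on $\{0,1,\dots,q-1\}$, the random variables $$ \frac{S_{\chi,H}(X)}{\sqrt{H}} $$ do not converge in distribution to $Z_1 + iZ_2$ as $q \rightarrow \infty$ through the primes, where $Z_1, Z_2$ are independent $N(0,1/2)$ random variables.
   Context: For a Dirichlet character $\chi$ modulo a prime $q$, a real number $H$ with $1 \le H \le q$, and $x \in \{0,1,\dots,q-1\}$, define $S_{\chi,H}(x) := \sum_{x < n \leq x+H} \chi(n)$ (sum over integers $n$). Here $\log^{A} q = (\log q)^{A}$, and $N(0,1/2)$ is the real Gaussian distribution with mean $0$ and variance $1/2$. *)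

theory Defs
  imports "HOL-Probability.Probability" "HOL-Computational_Algebra.Primes"
begin

text \<open>The coprimality clause forces \<open>chi 1 \<noteq> 0\<close>, hence \<open>chi 1 = 1\<close> by multiplicativity, and makes
  \<open>chi\<close> vanish exactly on the integers not coprime to the modulus.\<close>

definition dirichlet_character :: "nat \<Rightarrow> (int \<Rightarrow> complex) \<Rightarrow> bool" where
  "dirichlet_character q chi \<longleftrightarrow>
     q > 0 \<and>
     (\<forall>n. chi (n + int q) = chi n) \<and>
     (\<forall>m n. chi (m * n) = chi m * chi n) \<and>
     (\<forall>n. chi n \<noteq> 0 \<longleftrightarrow> coprime n (int q))"

definition real_character :: "(int \<Rightarrow> complex) \<Rightarrow> bool" where
  "real_character chi \<longleftrightarrow> (\<forall>n. chi n \<in> \<real>)"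

definition short_char_sum :: "(int \<Rightarrow> complex) \<Rightarrow> real \<Rightarrow> int \<Rightarrow> complex" where
  "short_char_sum chi H x =
     (\<Sum>n | real_of_int x < real_of_int n \<and> real_of_int n \<le> real_of_int x + H. chi n)"

lemma short_char_sum_altdef:
  "short_char_sum chi H x = (\<Sum>n\<in>{x<..\<lfloor>real_of_int x + H\<rfloor>}. chi n)"
  unfolding short_char_sum_def
  by (intro sum.cong set_eqI) (simp_all only: mem_Collect_eq greaterThanAtMost_iff of_int_less_iff le_floor_iff)

definition primes_at_top :: "nat filter" where
  "primes_at_top = inf at_top (principal {q. prime q})"

lemma eventually_primes_at_top:
  "eventually P primes_at_top \<longleftrightarrow> (\<exists>q0. \<forall>q\<ge>q0. prime q \<longrightarrow> P q)"
  by (simp add: primes_at_top_def eventually_inf_principal eventually_at_top_linorder)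

lemma primes_at_top_neq_bot: "primes_at_top \<noteq> bot"
proof
  assume "primes_at_top = bot"
  then have "eventually (\<lambda>_. False) primes_at_top" by simp
  then obtain q0 where "\<not> prime q" if "q \<ge> q0" for q :: nat
    by (auto simp: eventually_primes_at_top)
  then show False
    using bigger_prime[of q0] less_imp_le by blast
qed

text \<open>The library's \<open>weak_conv_m\<close> compares distribution functions and so only covers sequences of
  measures on the reals; here the random variables are complex-valued and indexed by the primes.\<close>

definition weak_conv_on ::
  "('i \<Rightarrow> 'a :: topological_space measure) \<Rightarrow> 'a measure \<Rightarrow> 'i filter \<Rightarrow> bool" where
  "weak_conv_on \<mu> \<nu> F \<longleftrightarrow>
     (\<forall>f :: 'a \<Rightarrow> real. continuous_on UNIV f \<and> bounded (range f) \<longrightarrow>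
        ((\<lambda>i. \<integral>z. f z \<partial>\<mu> i) \<longlongrightarrow> (\<integral>z. f z \<partial>\<nu>)) F)"

text \<open>The library's \<open>normal_density\<close> takes the standard deviation, not the variance.\<close>

definition normal_half :: "real measure" where
  "normal_half = density lborel (\<lambda>x. ennreal (normal_density 0 (sqrt (1/2)) x))"

definition complex_gaussian :: "complex measure" where
  "complex_gaussian =
     distr (normal_half \<Otimes>\<^sub>M normal_half) borel (\<lambda>(x, y). complex_of_real x + \<i> * complex_of_real y)"

lemma (in prob_space) distr_complex_gaussian:
  assumes indep: "indep_var borel Z1 borel Z2"
    and Z1: "distributed M lborel Z1 (\<lambda>x. ennreal (normal_density 0 (sqrt (1/2)) x))"
    and Z2: "distributed M lborel Z2 (\<lambda>x. ennreal (normal_density 0 (sqrt (1/2)) x))"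
  shows "distr M borel (\<lambda>\<omega>. complex_of_real (Z1 \<omega>) + \<i> * complex_of_real (Z2 \<omega>)) = complex_gaussian"
proof -
  have [measurable]: "Z1 \<in> borel_measurable M" "Z2 \<in> borel_measurable M"
    using indep by (auto dest: indep_var_rv1 indep_var_rv2)
  have "distr M borel Z1 = distr M lborel Z1" "distr M borel Z2 = distr M lborel Z2"
    by (auto intro!: distr_cong)
  then have "distr M borel Z1 = normal_half" "distr M borel Z2 = normal_half"
    using Z1 Z2 by (auto simp: distributed_def normal_half_def)
  then have eq: "normal_half \<Otimes>\<^sub>M normal_half = distr M (borel \<Otimes>\<^sub>M borel) (\<lambda>\<omega>. (Z1 \<omega>, Z2 \<omega>))"
    using indep by (simp add: indep_var_distribution_eq)
  show ?thesis
    unfolding complex_gaussian_def eq by (subst distr_distr) (auto simp: comp_def)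
qed

end

theory Submission
  imports Defs "HOL-Number_Theory.Number_Theory" "HOL-Real_Asymp.Real_Asymp"
begin

text \<open>
  Let \<open>N = \<lfloor>H\<rfloor>\<close>, \<open>E(a) = \<Sum>h\<le>N. e(ah/q)\<close> and let \<open>\<tau>\<close> be the Gauss sum of the conjugate
  character, so that \<open>\<tau> S(x) = \<Sum>a. cnj (\<chi> a) E(a) e(ax/q)\<close> and \<open>|\<tau>|\<^sup>2 = q\<close>. By Parseval,
  \<open>|S|\<^sup>2 / H\<close> has mean at most \<open>1\<close>, the second moment of the Gaussian. It therefore suffices to
  choose \<open>\<chi>\<close> such that a fixed proportion of this mean comes from \<open>x \<in> [q - N, q)\<close>, a set of
  probability \<open>N / q \<rightarrow> 0\<close>: the truncated moments \<open>min (|S|\<^sup>2 / H) b\<close> then stay below those of the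
  Gaussian for large \<open>b\<close>. By Cauchy-Schwarz this happens as soon as \<open>\<Sum>a. cnj (\<chi> a) |E(a)|\<^sup>2\<close>
  has the order \<open>q N\<close> of its trivial bound.

  Such \<open>\<chi>\<close> is found by the resonance method, with a resonator supported on a set \<open>B \<subseteq> [1, sqrt q]\<close>
  which is almost invariant under multiplication by the \<open>y\<close>-smooth numbers up to
  \<open>q / (6N) \<approx> (log q)\<^sup>A / 6\<close>. Here \<open>y\<close> is a small power of \<open>log q\<close>, so the smooth numbers have positive
  density in that range, and there \<open>|E(a)|\<^sup>2 \<ge> N\<^sup>2 / 4\<close>.
\<close>

section \<open>A weak form of Mertens' theorem\<close>

lemma card_multiples_atLeastAtMost:
  fixes d n :: nat
  assumes "d > 0"
  shows "card {m\<in>{1..n}. d dvd m} = n div d"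
proof -
  have "{m\<in>{1..n}. d dvd m} = (*) d ` {1..n div d}"
  proof (intro equalityI subsetI)
    fix m assume "m \<in> {m\<in>{1..n}. d dvd m}"
    then obtain k where "m = d * k" "m \<le> n" "m \<ge> 1" by auto
    then show "m \<in> (*) d ` {1..n div d}"
      using assms by (intro image_eqI[of _ _ k]) (auto simp: less_eq_div_iff_mult_less_eq mult.commute intro: Suc_leI)
  next
    fix m assume "m \<in> (*) d ` {1..n div d}"
    then show "m \<in> {m\<in>{1..n}. d dvd m}"
      using assms by (auto simp: less_eq_div_iff_mult_less_eq mult.commute intro: Suc_leI)
  qed
  moreover have "inj_on ((*) d) {1..n div d}"
    using assms by (auto simp: inj_on_def)
  ultimately show ?thesis by (simp add: card_image)
qed

lemma ln_eq_sum_prime_factors: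
  fixes m :: nat
  assumes "m > 0"
  shows "ln (real m) = (\<Sum>p\<in>prime_factors m. real (multiplicity p m) * ln (real p))"
proof -
  have "real m = real (\<Prod>p\<in>prime_factors m. p ^ multiplicity p m)"
    using prime_factorization_nat[OF assms] by (rule arg_cong)
  also have "\<dots> = (\<Prod>p\<in>prime_factors m. real p ^ multiplicity p m)" by simp
  finally have "ln (real m) = ln (\<Prod>p\<in>prime_factors m. real p ^ multiplicity p m)" by (rule arg_cong)
  also have "\<dots> = (\<Sum>p\<in>prime_factors m. ln (real p ^ multiplicity p m))"
    by (rule ln_prod) (auto simp: in_prime_factors_iff prime_gt_0_nat)
  also have "\<dots> = (\<Sum>p\<in>prime_factors m. real (multiplicity p m) * ln (real p))"
    by (intro sum.cong) (auto simp: ln_realpow in_prime_factors_iff prime_gt_0_nat)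
  finally show ?thesis .
qed

lemma sum_ln_prime_divisors_le:
  fixes m :: nat
  assumes "m > 0"
  shows "(\<Sum>p\<in>prime_factors m. ln (real p)) \<le> ln (real m)"
  unfolding ln_eq_sum_prime_factors[OF assms]
proof (intro sum_mono)
  fix p assume "p \<in> prime_factors m"
  then have "multiplicity p m \<ge> 1" "p \<ge> 1"
    using assms by (auto simp: prime_factors_multiplicity Suc_le_eq prime_gt_0_nat)
  then show "ln (real p) \<le> real (multiplicity p m) * ln (real p)"
    using mult_right_mono[of 1 "real (multiplicity p m)" "ln (real p)"] by simp
qed

text \<open>Counts the pairs of a number up to \<open>n\<close> and a prime dividing it, with weight
  \<open>ln p\<close>. Each number receives at most its logarithm, each prime contributes
  \<open>ln p * (n div p)\<close>.\<close>

lemma sum_ln_prime_over_prime_le: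
  fixes n :: nat
  assumes "n > 0"
  shows "(\<Sum>p | prime p \<and> p \<le> n. ln (real p) / real p) \<le> 2 * ln (real n)"
proof -
  define P where "P = {p::nat. prime p \<and> p \<le> n}"
  have fin: "finite P" unfolding P_def by simp
  have "real n * (\<Sum>p\<in>P. ln (real p) / real p) \<le> (\<Sum>p\<in>P. 2 * (ln (real p) * real (n div p)))"
    unfolding sum_distrib_left
  proof (intro sum_mono)
    fix p assume "p \<in> P"
    then have p: "prime p" "p \<le> n" "p > 0" by (auto simp: P_def prime_gt_0_nat)
    \<comment> \<open>As \<open>p\<close> is at most \<open>n\<close>, the quotient is at least 1,
      so rounding down costs at most a factor 2.\<close>
    have "n < p * (n div p + 1)"
      using p(3) by (metis Suc_eq_plus1 dividend_less_times_div mult_Suc_right add.commute)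
    also have "\<dots> \<le> p * (2 * (n div p))"
      using p by (intro mult_left_mono) (auto simp: div_greater_zero_iff Suc_le_eq)
    finally have "real n \<le> real (p * (2 * (n div p)))" by linarith
    then have "real n / real p \<le> 2 * real (n div p)"
      using p(3) by (simp add: field_simps)
    then have "ln (real p) * (real n / real p) \<le> ln (real p) * (2 * real (n div p))"
      using p by (intro mult_left_mono) auto
    then show "real n * (ln (real p) / real p) \<le> 2 * (ln (real p) * real (n div p))"
      by (simp add: mult_ac)
  qed
  also have "\<dots> = 2 * (\<Sum>p\<in>P. \<Sum>m | m \<in> {1..n} \<and> p dvd m. ln (real p))"
    by (auto simp: sum_distrib_left card_multiples_atLeastAtMost[OF prime_gt_0_nat, simplified] P_def mult_ac intro!: sum.cong)
  also have "(\<Sum>p\<in>P. \<Sum>m | m \<in> {1..n} \<and> p dvd m. ln (real p))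
      = (\<Sum>m\<in>{1..n}. \<Sum>p | p \<in> P \<and> p dvd m. ln (real p))"
    by (rule sum.swap_restrict[OF fin]) simp
  also have "\<dots> \<le> (\<Sum>m\<in>{1..n}. ln (real n))"
  proof (intro sum_mono)
    fix m assume m: "m \<in> {1..n}"
    have "p \<le> n" if "p dvd m" for p
      using dvd_imp_le[OF that] m by simp
    then have "{p\<in>P. p dvd m} = prime_factors m"
      using m unfolding P_def in_prime_factors_iff set_eq_iff mem_Collect_eq by simp blast
    then have "(\<Sum>p | p \<in> P \<and> p dvd m. ln (real p)) \<le> ln (real m)"
      using sum_ln_prime_divisors_le[of m] m by simp
    also have "\<dots> \<le> ln (real n)" using m by simp
    finally show "(\<Sum>p | p \<in> P \<and> p dvd m. ln (real p)) \<le> ln (real n)" .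
  qed
  finally have "real n * (\<Sum>p\<in>P. ln (real p) / real p) \<le> real n * (2 * ln (real n))"
    by (simp add: mult_ac)
  then show ?thesis using assms unfolding P_def by simp
qed

lemma multiplicity_eq_card:
  fixes p m n :: nat
  assumes "prime p" "m > 0" "m \<le> n"
  shows "multiplicity p m = card {k\<in>{1..n}. p ^ k dvd m}"
proof -
  have "multiplicity p m \<le> n"
  proof -
    have "multiplicity p m < p ^ multiplicity p m"
      using prime_gt_1_nat[OF assms(1)] by (intro power_gt_expt) simp
    also have "\<dots> \<le> m" using assms by (intro dvd_imp_le multiplicity_dvd)
    finally show ?thesis using assms by simp
  qed
  then have "{k\<in>{1..n}. p ^ k dvd m} = {1..multiplicity p m}"
    using assms by (auto simp: multiplicity_dvd' intro!: multiplicity_geI dest: not_prime_unit)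
  then show ?thesis by simp
qed

text \<open>Legendre's formula for the exponent of \<open>p\<close> in the factorial of
  \<open>n\<close>, bounded by a geometric series.\<close>

lemma sum_multiplicity_le:
  fixes p n :: nat
  assumes "prime p"
  shows "(\<Sum>m\<in>{1..n}. real (multiplicity p m)) \<le> real n / (real p - 1)"
proof -
  have p: "real p > 1" using assms prime_gt_1_nat by simp
  have geo: "(real p - 1) * (\<Sum>k\<in>{1..N}. 1 / real p ^ k) = 1 - 1 / real p ^ N" for N
    using p by (induction N) (auto simp: field_simps)
  have "(\<Sum>m\<in>{1..n}. real (multiplicity p m))
      = (\<Sum>m\<in>{1..n}. \<Sum>k | k \<in> {1..n} \<and> p ^ k dvd m. 1)"
    using assms by (intro sum.cong refl) (simp add: multiplicity_eq_card[of p _ n])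
  also have "\<dots> = (\<Sum>k\<in>{1..n}. \<Sum>m | m \<in> {1..n} \<and> p ^ k dvd m. 1)"
    by (rule sum.swap_restrict) simp_all
  also have "\<dots> = (\<Sum>k\<in>{1..n}. real (n div p ^ k))"
    using assms by (intro sum.cong) (auto simp: card_multiples_atLeastAtMost[simplified] prime_gt_0_nat)
  also have "\<dots> \<le> (\<Sum>k\<in>{1..n}. real n * (1 / real p ^ k))"
    by (intro sum_mono) (use of_nat_div_le_of_nat[of n] in \<open>simp flip: of_nat_power\<close>)
  also have "\<dots> = real n * (\<Sum>k\<in>{1..n}. 1 / real p ^ k)" by (simp add: sum_distrib_left)
  also have "(\<Sum>k\<in>{1..n}. 1 / real p ^ k) = (1 - 1 / real p ^ n) / (real p - 1)"
    using geo[of n] p by (simp add: field_simps)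
  also have "real n * \<dots> \<le> real n * (1 / (real p - 1))"
    using p by (intro mult_left_mono divide_right_mono) auto
  finally show ?thesis by simp
qed

text \<open>A weak Stirling bound. The induction step reduces to \<open>n * ln (1 + 1/n)\<close>
  being at most 1.\<close>

lemma sum_ln_ge:
  fixes n :: nat
  shows "real n * ln (real n) - real n \<le> (\<Sum>m\<in>{1..n}. ln (real m))"
proof (induction n)
  case (Suc n)
  show ?case
  proof (cases "n = 0")
    case False
    have "ln (real (Suc n)) - ln (real n) = ln (1 + 1 / real n)"
      using False ln_div[of "1 + real n" "real n"] by (simp add: add_divide_distrib add.commute)
    also have "\<dots> \<le> 1 / real n" using False by (intro ln_add_one_self_le_self) auto
    finally have "real n * (ln (real (Suc n)) - ln (real n)) \<le> 1"
      using False by (simp add: field_simps)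
    then show ?thesis using Suc by (simp add: algebra_simps)
  qed simp
qed simp

text \<open>Factorises the factorial of \<open>n\<close>: its logarithm is large by Stirling, while
  each prime contributes at most \<open>n * ln p / (p - 1)\<close>. The factor 2 comes from
  replacing \<open>p - 1\<close> by \<open>p / 2\<close>.\<close>

lemma sum_ln_prime_over_prime_ge:
  fixes n :: nat
  assumes "n > 0"
  shows "ln (real n) - 1 \<le> 2 * (\<Sum>p | prime p \<and> p \<le> n. ln (real p) / real p)"
proof -
  define P where "P = {p::nat. prime p \<and> p \<le> n}"
  have fin: "finite P" unfolding P_def by simp
  have "real n * ln (real n) - real n \<le> (\<Sum>m\<in>{1..n}. ln (real m))" by (rule sum_ln_ge)
  also have "\<dots> = (\<Sum>m\<in>{1..n}. \<Sum>p\<in>P. real (multiplicity p m) * ln (real p))"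
  proof (intro sum.cong refl)
    fix m assume m: "m \<in> {1..n}"
    have sub: "prime_factors m \<subseteq> P"
    proof
      fix p assume "p \<in> prime_factors m"
      then have "prime p" "p dvd m" by auto
      then show "p \<in> P" using m dvd_imp_le[of p m] by (auto simp: P_def)
    qed
    have "ln (real m) = (\<Sum>p\<in>prime_factors m. real (multiplicity p m) * ln (real p))"
      using m by (intro ln_eq_sum_prime_factors) auto
    also have "\<dots> = (\<Sum>p\<in>P. real (multiplicity p m) * ln (real p))"
      using sub fin m by (intro sum.mono_neutral_left) (auto simp: P_def prime_factors_multiplicity)
    finally show "ln (real m) = (\<Sum>p\<in>P. real (multiplicity p m) * ln (real p))" .
  qed
  also have "\<dots> = (\<Sum>p\<in>P. (\<Sum>m\<in>{1..n}. real (multiplicity p m)) * ln (real p))"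
    by (subst sum.swap) (simp add: sum_distrib_right)
  also have "\<dots> \<le> (\<Sum>p\<in>P. 2 * real n * (ln (real p) / real p))"
  proof (intro sum_mono)
    fix p assume "p \<in> P"
    then have p: "prime p" "real p \<ge> 2" using prime_ge_2_nat by (auto simp: P_def)
    have "(\<Sum>m\<in>{1..n}. real (multiplicity p m)) \<le> real n / (real p - 1)"
      using p by (intro sum_multiplicity_le)
    also have "\<dots> \<le> real n / (real p / 2)" using p by (intro divide_left_mono) auto
    finally have "(\<Sum>m\<in>{1..n}. real (multiplicity p m)) * ln (real p) \<le> real n / (real p / 2) * ln (real p)"
      using p by (intro mult_right_mono) auto
    then show "(\<Sum>m\<in>{1..n}. real (multiplicity p m)) * ln (real p) \<le> 2 * real n * (ln (real p) / real p)"
      by (simp add: mult_ac)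
  qed
  also have "\<dots> = real n * (2 * (\<Sum>p\<in>P. ln (real p) / real p))" by (simp add: sum_distrib_left mult_ac)
  finally have "real n * (ln (real n) - 1) \<le> real n * (2 * (\<Sum>p\<in>P. ln (real p) / real p))"
    by (simp add: algebra_simps)
  then show ?thesis using assms unfolding P_def by simp
qed

text \<open>With \<open>L = ln z\<close>, the two bounds above leave
  \<open>(8 * L - 1) / 2 - 2 * L = 2 * L - 1/2\<close>, which is at least \<open>L\<close> because
  \<open>L\<close> is at least \<open>1/2\<close>. The exponent 8 gives room for both crude factors
  2.\<close>

lemma sum_ln_prime_over_prime_between:
  fixes z :: nat
  assumes "z \<ge> 2"
  shows "ln (real z) \<le> (\<Sum>p | prime p \<and> z < p \<and> p \<le> z ^ 8. ln (real p) / real p)"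
proof -
  define f where "f = (\<lambda>p. ln (real p) / real p)"
  have z: "z \<le> z ^ 8" using assms by (intro self_le_power) auto
  have eq: "{p. prime p \<and> p \<le> z ^ 8} = {p. prime p \<and> p \<le> z} \<union> {p. prime p \<and> z < p \<and> p \<le> z ^ 8}"
    using z by auto
  have "sum f {p. prime p \<and> p \<le> z ^ 8} = sum f {p. prime p \<and> p \<le> z} + sum f {p. prime p \<and> z < p \<and> p \<le> z ^ 8}"
    unfolding eq by (intro sum.union_disjoint) auto
  moreover have "sum f {p. prime p \<and> p \<le> z} \<le> 2 * ln (real z)"
    unfolding f_def using assms by (intro sum_ln_prime_over_prime_le) auto
  moreover have "ln (real (z ^ 8)) - 1 \<le> 2 * sum f {p. prime p \<and> p \<le> z ^ 8}"
    unfolding f_def using assms by (intro sum_ln_prime_over_prime_ge) auto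
  moreover have "ln (real (z ^ 8)) = 8 * ln (real z)" using assms by (simp add: ln_realpow)
  moreover have "ln (real z) \<ge> 1 / 2"
  proof -
    have "ln 2 \<le> ln (real z)" using assms by (subst ln_le_cancel_iff) auto
    then show ?thesis using ln2_ge_two_thirds by linarith
  qed
  ultimately have "ln (real z) \<le> sum f {p. prime p \<and> z < p \<and> p \<le> z ^ 8}" by linarith
  then show ?thesis unfolding f_def .
qed

section \<open>Smooth numbers\<close>

text \<open>A family of \<open>y\<close>-smooth numbers. All integers up to \<open>y\<close>, not
  only primes, serve as bases, so that each of them lies in level 1 without being factorised.
  Representations are not unique, which is harmless since cardinalities are only bounded above by
  the number of exponent vectors. Bounding each exponent separately makes levels add up under
  multiplication.\<close>

definition box_products :: "nat \<Rightarrow> nat \<Rightarrow> nat set" where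
  "box_products y j = (\<lambda>e. \<Prod>m\<in>{1..y}. m ^ e m) ` ({1..y} \<rightarrow>\<^sub>E {..j})"

lemma box_productsI:
  assumes "\<And>m. m \<in> {1..y} \<Longrightarrow> e m \<le> j"
  shows "(\<Prod>m\<in>{1..y}. m ^ e m) \<in> box_products y j"
  unfolding box_products_def
proof (rule image_eqI[where x = "restrict e {1..y}"])
  show "(\<Prod>m\<in>{1..y}. m ^ e m) = (\<Prod>m\<in>{1..y}. m ^ restrict e {1..y} m)"
    by (intro prod.cong) auto
  show "restrict e {1..y} \<in> {1..y} \<rightarrow>\<^sub>E {..j}"
    using assms by auto
qed

lemma finite_box_products: "finite (box_products y j)"
  unfolding box_products_def by (intro finite_imageI finite_PiE) auto

lemma card_box_products_le: "card (box_products y j) \<le> (j + 1) ^ y"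
proof -
  have "card (box_products y j) \<le> card ({1..y} \<rightarrow>\<^sub>E {..j})"
    unfolding box_products_def by (intro card_image_le finite_PiE) auto
  then show ?thesis by (simp add: card_PiE)
qed

lemma box_products_pos: "n \<in> box_products y j \<Longrightarrow> n > 0"
  unfolding box_products_def by (auto intro!: prod_pos)

lemma box_products_le: "n \<in> box_products y j \<Longrightarrow> n \<le> y ^ (j * y)"
proof -
  assume "n \<in> box_products y j"
  then obtain e where e: "e \<in> {1..y} \<rightarrow>\<^sub>E {..j}" "n = (\<Prod>m\<in>{1..y}. m ^ e m)"
    unfolding box_products_def by auto
  have "n \<le> (\<Prod>m\<in>{1..y}. y ^ j)"
    unfolding e(2)
  proof (intro prod_mono conjI)
    fix m assume m: "m \<in> {1..y}"
    then have "m ^ e m \<le> y ^ e m" by (intro power_mono) auto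
    also have "\<dots> \<le> y ^ j" using e(1) m by (intro power_increasing) auto
    finally show "m ^ e m \<le> y ^ j" .
  qed auto
  then show ?thesis by (simp add: power_mult)
qed

lemma box_products_mult:
  assumes "a \<in> box_products y i" "b \<in> box_products y j"
  shows "a * b \<in> box_products y (i + j)"
proof -
  obtain e where e: "e \<in> {1..y} \<rightarrow>\<^sub>E {..i}" "a = (\<Prod>m\<in>{1..y}. m ^ e m)"
    using assms(1) unfolding box_products_def by auto
  obtain f where f: "f \<in> {1..y} \<rightarrow>\<^sub>E {..j}" "b = (\<Prod>m\<in>{1..y}. m ^ f m)"
    using assms(2) unfolding box_products_def by auto
  have "a * b = (\<Prod>m\<in>{1..y}. m ^ (e m + f m))"
    unfolding e(2) f(2) prod.distrib[symmetric] by (intro prod.cong) (auto simp: power_add)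
  also have "\<dots> \<in> box_products y (i + j)"
    using e(1) f(1) by (intro box_productsI add_mono) (auto simp: PiE_iff)
  finally show ?thesis .
qed

lemma mem_box_products_1:
  assumes "1 \<le> n" "n \<le> y"
  shows "n \<in> box_products y 1"
proof -
  have "n = (\<Prod>m\<in>{1..y}. if m = n then m else 1)"
    using assms by simp
  also have "\<dots> = (\<Prod>m\<in>{1..y}. m ^ (if m = n then 1 else 0))"
    by (intro prod.cong) auto
  also have "\<dots> \<in> box_products y 1" by (rule box_productsI) auto
  finally show ?thesis .
qed

lemma one_mem_box_products: "1 \<in> box_products y j"
  using box_productsI[of y "\<lambda>_. 0" j] by simp

lemma box_products_mono: "i \<le> j \<Longrightarrow> box_products y i \<subseteq> box_products y j"
  using box_products_mult[OF _ one_mem_box_products, of _ y i "j - i"] by auto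

text \<open>Induction step: the numbers \<open>p * b\<close> with a prime \<open>p \<in> (z, z\<^sup>8]\<close> are counted with weight
  \<open>ln p\<close>; as the prime divisors of \<open>a\<close> have total weight at most \<open>ln a\<close>, multiplicities cost only
  a constant factor.\<close>

lemma box_products_density:
  "\<exists>c>0. \<forall>z\<ge>2. \<forall>x\<ge>1. x \<le> real z ^ (8 + j) \<longrightarrow>
     c * x \<le> real (card {a \<in> box_products (z ^ 8) (j + 1). real a \<le> x})"
proof (induction j)
  case 0
  have "1 / 2 * x \<le> real (card {a \<in> box_products (z ^ 8) 1. real a \<le> x})"
    if "z \<ge> 2" "x \<ge> 1" "x \<le> real z ^ 8" for z :: nat and x
  proof -
    have "{1..nat \<lfloor>x\<rfloor>} \<subseteq> {a \<in> box_products (z ^ 8) 1. real a \<le> x}"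
    proof
      fix a assume "a \<in> {1..nat \<lfloor>x\<rfloor>}"
      then have a: "1 \<le> a" "real a \<le> x" using that by (auto simp: le_nat_iff le_floor_iff)
      then have "real a \<le> real z ^ 8" using that by linarith
      then have "a \<le> z ^ 8" by (simp flip: of_nat_power)
      then show "a \<in> {a \<in> box_products (z ^ 8) 1. real a \<le> x}"
        using a mem_box_products_1 by simp
    qed
    then have "card {1..nat \<lfloor>x\<rfloor>} \<le> card {a \<in> box_products (z ^ 8) 1. real a \<le> x}"
      by (intro card_mono) (auto simp: finite_box_products)
    moreover have "x \<le> 2 * real (nat \<lfloor>x\<rfloor>)"
    proof -
      have "real (nat \<lfloor>x\<rfloor>) = of_int \<lfloor>x\<rfloor>" "1 \<le> \<lfloor>x\<rfloor>" using that by auto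
      then show ?thesis by linarith
    qed
    ultimately show ?thesis by simp
  qed
  then show ?case by (intro exI[of _ "1/2"]) auto
next
  case (Suc j)
  then obtain c where c: "c > 0"
    and IH: "\<And>z x. z \<ge> 2 \<Longrightarrow> x \<ge> 1 \<Longrightarrow> x \<le> real z ^ (8 + j) \<Longrightarrow>
      c * x \<le> real (card {a \<in> box_products (z ^ 8) (j + 1). real a \<le> x})"
    by blast
  \<comment> \<open>\<open>j + 9\<close> is the new exponent \<open>8 + Suc j\<close>. The primes
    supply weight at least \<open>ln z\<close>, while a number up to \<open>z ^ (j + 9)\<close> can
    absorb at most \<open>(j + 9) * ln z\<close>; the loss is the quotient.\<close>
  have "c / (j + 9) * x \<le> real (card {a \<in> box_products (z ^ 8) (Suc j + 1). real a \<le> x})"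
    if z: "z \<ge> 2" and x: "x \<ge> 1" "x \<le> real z ^ (8 + Suc j)" for z :: nat and x
  proof (cases "x \<le> real z ^ (8 + j)")
    case True
    have "c * x / (j + 9) \<le> c * x / 1"
      using c x by (intro divide_left_mono) auto
    then have "c / (j + 9) * x \<le> c * x" by simp
    also have "\<dots> \<le> real (card {a \<in> box_products (z ^ 8) (j + 1). real a \<le> x})"
      using IH z x True by blast
    also have "\<dots> \<le> real (card {a \<in> box_products (z ^ 8) (Suc j + 1). real a \<le> x})"
      using box_products_mono[of "j + 1" "Suc j + 1" "z ^ 8"]
      by (intro of_nat_mono card_mono) (auto simp: finite_box_products)
    finally show ?thesis .
  next
    case False
    \<comment> \<open>Since \<open>x\<close> exceeds \<open>z ^ (8 + j)\<close>, which is at least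
      \<open>z ^ 8\<close>, the quotient \<open>x / p\<close> is at least 1; since \<open>p\<close>
      exceeds \<open>z\<close>, the quotient falls back into the range of the induction
      hypothesis.\<close>
    define P where "P = {p. prime p \<and> z < p \<and> p \<le> z ^ 8}"
    define D where "D = (\<lambda>p. {b \<in> box_products (z ^ 8) (j + 1). real b \<le> x / real p})"
    define D' where "D' = {a \<in> box_products (z ^ 8) (Suc j + 1). real a \<le> x}"
    have fin: "finite P" "finite D'" "finite (D p)" for p
      unfolding P_def D'_def D_def by (simp_all add: finite_box_products)
    have lnz: "ln (real z) > 0" using z by simp
    have P: "prime p" "z < p" "p \<le> z ^ 8" "p > 1" if "p \<in> P" for p
      using that z by (auto simp: P_def)
    have "c * x * ln (real z) \<le> c * x * (\<Sum>p\<in>P. ln (real p) / real p)"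
      using sum_ln_prime_over_prime_between[OF z] c x unfolding P_def by (intro mult_left_mono) auto
    also have "\<dots> = (\<Sum>p\<in>P. ln (real p) * (c * (x / real p)))"
      by (simp add: sum_distrib_left mult_ac)
    also have "\<dots> \<le> (\<Sum>p\<in>P. ln (real p) * real (card (D p)))"
    proof (intro sum_mono mult_left_mono)
      fix p assume p: "p \<in> P"
      have "real p \<le> real (z ^ 8)" using P[OF p] by (intro of_nat_mono)
      also have "\<dots> \<le> real z ^ (8 + j)" using z by (auto intro: power_increasing)
      also have "\<dots> \<le> x" using False by simp
      finally have "1 \<le> x / real p" using P[OF p] by (simp add: field_simps)
      moreover have "x / real p \<le> real z ^ (8 + j)"
      proof -
        have "x \<le> real z * real z ^ (8 + j)" using x(2) by (simp only: add_Suc_right power_Suc)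
        also have "\<dots> \<le> real p * real z ^ (8 + j)"
          using P[OF p] by (intro mult_right_mono) auto
        finally show ?thesis using P[OF p] by (simp add: field_simps)
      qed
      ultimately show "c * (x / real p) \<le> real (card (D p))"
        unfolding D_def using IH z by blast
      show "0 \<le> ln (real p)" using P[OF p] by simp
    qed
    also have "\<dots> \<le> (\<Sum>p\<in>P. \<Sum>a | a \<in> D' \<and> p dvd a. ln (real p))"
    proof (intro sum_mono)
      fix p assume p: "p \<in> P"
      have "(*) p ` D p \<subseteq> {a. a \<in> D' \<and> p dvd a}"
      proof
        fix a assume "a \<in> (*) p ` D p"
        then obtain b where b: "b \<in> box_products (z ^ 8) (j + 1)" "real b \<le> x / real p" "a = p * b"
          by (auto simp: D_def)
        have "p * b \<in> box_products (z ^ 8) (1 + (j + 1))"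
          using P[OF p] b by (intro box_products_mult mem_box_products_1) auto
        moreover have "real (p * b) \<le> x" using b P[OF p] by (simp add: field_simps)
        ultimately show "a \<in> {a. a \<in> D' \<and> p dvd a}" using b by (simp add: D'_def)
      qed
      then have "card ((*) p ` D p) \<le> card {a. a \<in> D' \<and> p dvd a}"
        using fin by (intro card_mono) auto
      moreover have "card ((*) p ` D p) = card (D p)"
        using P[OF p] by (intro card_image) (auto simp: inj_on_def)
      ultimately have "ln (real p) * real (card (D p)) \<le> ln (real p) * real (card {a. a \<in> D' \<and> p dvd a})"
        using P[OF p] by (intro mult_left_mono) auto
      then show "ln (real p) * real (card (D p)) \<le> (\<Sum>a | a \<in> D' \<and> p dvd a. ln (real p))"
        by (simp add: mult.commute)
    qed
    also have "\<dots> = (\<Sum>a\<in>D'. \<Sum>p | p \<in> P \<and> p dvd a. ln (real p))"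
      by (rule sum.swap_restrict) (use fin in auto)
    also have "\<dots> \<le> (\<Sum>a\<in>D'. (j + 9) * ln (real z))"
    proof (intro sum_mono)
      fix a assume a: "a \<in> D'"
      then have apos: "a > 0" using box_products_pos by (auto simp: D'_def)
      have "(\<Sum>p | p \<in> P \<and> p dvd a. ln (real p)) \<le> (\<Sum>p\<in>prime_factors a. ln (real p))"
        using apos by (intro sum_mono2) (auto simp: P_def in_prime_factors_iff prime_gt_0_nat Suc_le_eq)
      also have "\<dots> \<le> ln (real a)" using sum_ln_prime_divisors_le apos by blast
      also have "\<dots> \<le> ln (real z ^ (j + 9))"
      proof -
        have "real a \<le> x" using a by (simp add: D'_def)
        also have "x \<le> real z ^ (j + 9)" using x(2) by (simp add: add.commute)
        finally have "real a \<le> real z ^ (j + 9)" .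
        then show ?thesis using apos z by (subst ln_le_cancel_iff) auto
      qed
      also have "\<dots> = (j + 9) * ln (real z)" using z by (simp add: ln_realpow)
      finally show "(\<Sum>p | p \<in> P \<and> p dvd a. ln (real p)) \<le> (j + 9) * ln (real z)" .
    qed
    also have "\<dots> = real (card D') * (j + 9) * ln (real z)" by simp
    finally have "c * x \<le> real (card D') * (j + 9)" using lnz by simp
    then show ?thesis unfolding D'_def by (simp add: field_simps)
  qed
  then show ?case using c by (intro exI[of _ "c / (j + 9)"]) auto
qed

text \<open>Pigeonhole: \<open>card (box_products y j)\<close> grows only polynomially in \<open>j\<close>, so it cannot double at
  every step from \<open>j\<close> to \<open>j + i\<close>.\<close>

lemma almost_invariant_set:
  fixes y i t :: nat
  assumes "(i * t + 1) ^ y < 2 ^ t"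
  obtains B where "finite B" "B \<noteq> {}" "B \<subseteq> {1..y ^ (i * t * y)}"
    "\<And>a. a \<in> box_products y i \<Longrightarrow> card B \<le> 2 * card {n \<in> B. a * n \<in> B}"
proof -
  have "\<exists>s<t. card (box_products y (i * Suc s)) \<le> 2 * card (box_products y (i * s))"
  proof (rule ccontr)
    assume "\<not> ?thesis"
    then have step: "2 * card (box_products y (i * s)) < card (box_products y (i * Suc s))" if "s < t" for s
      using that by (meson not_le)
    have "2 ^ s \<le> card (box_products y (i * s))" if "s \<le> t" for s
      using that
    proof (induction s)
      case 0
      have "box_products y (i * 0) \<noteq> {}" using one_mem_box_products by blast
      then show ?case using finite_box_products by (simp add: Suc_le_eq card_gt_0_iff)
    next
      case (Suc s)
      then show ?case using step[of s] by simp
    qed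
    from this[of t] show False using card_box_products_le[of y "i * t"] assms by simp
  qed
  then obtain s where s: "s < t" "card (box_products y (i * Suc s)) \<le> 2 * card (box_products y (i * s))"
    by blast
  show ?thesis
  proof (rule that[of "box_products y (i * Suc s)"])
    show "finite (box_products y (i * Suc s))" by (rule finite_box_products)
    show "box_products y (i * Suc s) \<noteq> {}" using one_mem_box_products by blast
    have "box_products y (i * Suc s) \<subseteq> box_products y (i * t)"
      using s by (intro box_products_mono mult_left_mono) auto
    then show "box_products y (i * Suc s) \<subseteq> {1..y ^ (i * t * y)}"
      using box_products_pos[of _ y "i * t"] box_products_le[of _ y "i * t"]
      by (auto simp: Suc_le_eq)
    fix a assume a: "a \<in> box_products y i"
    \<comment> \<open>Multiplication by \<open>a\<close> sends the lower level into the upper one,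
      so the whole lower level is counted; by the choice of \<open>s\<close> it makes up at least
      half of the upper level.\<close>
    have "box_products y (i * s) \<subseteq> {n \<in> box_products y (i * Suc s). a * n \<in> box_products y (i * Suc s)}"
      using box_products_mult[OF a, of _ "i * s"] box_products_mono[of "i * s" "i * Suc s" y] by auto
    then have "card (box_products y (i * s)) \<le> card {n \<in> box_products y (i * Suc s). a * n \<in> box_products y (i * Suc s)}"
      by (intro card_mono) (auto simp: finite_box_products)
    then show "card (box_products y (i * Suc s)) \<le>
        2 * card {n \<in> box_products y (i * Suc s). a * n \<in> box_products y (i * Suc s)}"
      using s(2) by simp
  qed
qed

section \<open>Dirichlet characters and Gauss sums\<close>

lemma periodic_int_mod:
  fixes f :: "int \<Rightarrow> 'a"
  assumes "\<And>n. f (n + m) = f n"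
  shows "f (n mod m) = f n"
proof -
  have nat: "f (k + int i * m) = f k" for k i
  proof (induction i)
    case (Suc i)
    have "f (k + int (Suc i) * m) = f ((k + int i * m) + m)" by (simp add: algebra_simps)
    then show ?case using assms Suc by simp
  qed simp
  have "f (k + i * m) = f k" for k i
    using nat[of k "nat i"] nat[of "k + i * m" "nat (- i)"] by (cases "i \<ge> 0") auto
  from this[of "n mod m" "n div m"] show ?thesis by (simp add: add.commute)
qed

text \<open>An affine map with invertible slope permutes the residues. Translations serve to
  evaluate sums of roots of unity, dilations to evaluate Gauss sums.\<close>

lemma sum_periodic_affine:
  fixes f :: "int \<Rightarrow> 'a :: comm_monoid_add"
  assumes "m > 0" "\<And>n. f (n + m) = f n" "coprime b m"
  shows "(\<Sum>x\<in>{0..<m}. f (b * x + c)) = (\<Sum>x\<in>{0..<m}. f x)"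
proof -
  define h where "h = (\<lambda>x. (b * x + c) mod m)"
  have "inj_on h {0..<m}"
  proof (rule inj_onI)
    fix x y assume xy: "x \<in> {0..<m}" "y \<in> {0..<m}" "h x = h y"
    then have "[b * x + c = b * y + c] (mod m)" by (simp add: h_def cong_def)
    then have "[x = y] (mod m)"
      using assms(3) by (simp add: cong_add_rcancel cong_mult_lcancel)
    then show "x = y" using xy by (simp add: cong_def)
  qed
  moreover have "h ` {0..<m} \<subseteq> {0..<m}" using assms(1) by (auto simp: h_def)
  ultimately have "bij_betw h {0..<m} {0..<m}"
    by (simp add: bij_betw_def endo_inj_surj)
  then have "(\<Sum>x\<in>{0..<m}. f (h x)) = (\<Sum>x\<in>{0..<m}. f x)"
    by (rule sum.reindex_bij_betw)
  then show ?thesis unfolding h_def periodic_int_mod[of f m, OF assms(2)] .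
qed

text \<open>The additive character \<open>e(k/q)\<close>. With \<open>q - 1\<close> in place of
  \<open>q\<close> it also supplies the values of the multiplicative characters.\<close>

definition unit_root :: "nat \<Rightarrow> int \<Rightarrow> complex" where
  "unit_root q k = cis (2 * pi * of_int k / of_nat q)"

lemma unit_root_add: "unit_root q (a + b) = unit_root q a * unit_root q b"
  by (simp add: unit_root_def cis_mult add_divide_distrib distrib_left)

lemma unit_root_minus: "unit_root q (- a) = cnj (unit_root q a)"
  by (simp add: unit_root_def cis_cnj)

lemma norm_unit_root [simp]: "norm (unit_root q a) = 1"
  by (simp add: unit_root_def)

lemma unit_root_eq_1_iff:
  assumes "q > 0"
  shows "unit_root q k = 1 \<longleftrightarrow> int q dvd k"
proof
  assume "unit_root q k = 1"
  then have "cos (2 * pi * of_int k / of_nat q) = 1"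
    by (simp add: unit_root_def complex_eq_iff)
  then obtain n :: int where "2 * pi * of_int k / of_nat q = of_int n * 2 * pi"
    by (auto simp: cos_one_2pi_int)
  then have "real_of_int k = real_of_int (n * int q)"
    using assms by (simp add: field_simps)
  then have "k = n * int q" by linarith
  then show "int q dvd k" by simp
next
  assume "int q dvd k"
  then obtain n where "k = int q * n" by auto
  then have "2 * pi * of_int k / of_nat q = 2 * pi * real_of_int n"
    using assms by simp
  then show "unit_root q k = 1" by (simp add: unit_root_def)
qed

lemma unit_root_dvd:
  assumes "q > 0" "int q dvd k"
  shows "unit_root q k = 1"
  using assms by (simp add: unit_root_eq_1_iff)

lemma unit_root_cong:
  assumes "q > 0" "[a = b] (mod int q)"
  shows "unit_root q a = unit_root q b"
proof -
  have "unit_root q a = unit_root q (b + (a - b))" by simp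
  also have "\<dots> = unit_root q b"
    unfolding unit_root_add using assms by (simp add: unit_root_dvd cong_iff_dvd_diff)
  finally show ?thesis .
qed

lemma sum_unit_root:
  assumes "q > 0"
  shows "(\<Sum>x\<in>{0..<int q}. unit_root q (a * x)) = (if int q dvd a then of_nat q else 0)"
proof (cases "int q dvd a")
  case True
  then show ?thesis using assms by (simp add: unit_root_dvd)
next
  case False
  define S where "S = (\<Sum>x\<in>{0..<int q}. unit_root q (a * x))"
  \<comment> \<open>Shifting the summation variable by 1 multiplies the sum by
    \<open>unit_root q a\<close>, which differs from 1, so the sum vanishes.\<close>
  have "(\<Sum>x\<in>{0..<int q}. unit_root q (a * (1 * x + 1))) = S"
    unfolding S_def using assms
    by (intro sum_periodic_affine) (auto simp: distrib_left unit_root_add unit_root_dvd)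
  then have "S * unit_root q a = S"
    by (simp add: distrib_left unit_root_add S_def sum_distrib_right)
  then show ?thesis using False assms unit_root_eq_1_iff[of q a] by (auto simp: S_def)
qed

text \<open>Expanding the square leaves only the diagonal, because distinct elements of
  \<open>A\<close> are incongruent. A general \<open>A\<close> covers both complete frequency sums
  and the interval \<open>{1..N}\<close>.\<close>

lemma parseval_unit_root:
  assumes "q > 0" "A \<subseteq> {0..<int q}"
  shows "(\<Sum>x\<in>{0..<int q}. (norm (\<Sum>a\<in>A. c a * unit_root q (a * x)))\<^sup>2)
    = real q * (\<Sum>a\<in>A. (norm (c a))\<^sup>2)"
proof -
  have fin: "finite A" using assms(2) finite_subset by blast
  have "complex_of_real (\<Sum>x\<in>{0..<int q}. (norm (\<Sum>a\<in>A. c a * unit_root q (a * x)))\<^sup>2)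
      = (\<Sum>x\<in>{0..<int q}. \<Sum>a\<in>A. \<Sum>b\<in>A. c a * cnj (c b) * unit_root q ((a - b) * x))"
    unfolding of_real_sum
  proof (intro sum.cong refl)
    fix x
    have "complex_of_real ((norm (\<Sum>a\<in>A. c a * unit_root q (a * x)))\<^sup>2)
        = (\<Sum>a\<in>A. c a * unit_root q (a * x)) * (\<Sum>b\<in>A. cnj (c b * unit_root q (b * x)))"
      unfolding complex_norm_square cnj_sum ..
    also have "\<dots> = (\<Sum>a\<in>A. \<Sum>b\<in>A. c a * cnj (c b) * unit_root q ((a - b) * x))"
      unfolding sum_product
    proof (intro sum.cong refl)
      fix a b
      have "unit_root q ((a - b) * x) = unit_root q (a * x) * cnj (unit_root q (b * x))"
        unfolding unit_root_minus[symmetric] unit_root_add[symmetric] by (simp add: algebra_simps)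
      then show "c a * unit_root q (a * x) * cnj (c b * unit_root q (b * x))
          = c a * cnj (c b) * unit_root q ((a - b) * x)"
        by simp
    qed
    finally show "complex_of_real ((norm (\<Sum>a\<in>A. c a * unit_root q (a * x)))\<^sup>2)
        = (\<Sum>a\<in>A. \<Sum>b\<in>A. c a * cnj (c b) * unit_root q ((a - b) * x))" .
  qed
  also have "\<dots> = (\<Sum>a\<in>A. \<Sum>b\<in>A. c a * cnj (c b) * (\<Sum>x\<in>{0..<int q}. unit_root q ((a - b) * x)))"
    by (subst sum.swap, rule sum.cong[OF refl], subst sum.swap) (simp add: sum_distrib_left)
  also have "\<dots> = (\<Sum>a\<in>A. \<Sum>b\<in>A. if a = b then of_nat q * (c a * cnj (c a)) else 0)"
  proof (intro sum.cong refl)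
    fix a b assume ab: "a \<in> A" "b \<in> A"
    have "int q dvd a - b \<longleftrightarrow> a = b"
    proof
      assume "int q dvd a - b"
      then have "a mod int q = b mod int q" by (simp add: mod_eq_dvd_iff)
      then show "a = b" using ab assms(2) by (auto simp: subset_iff)
    qed simp
    then show "c a * cnj (c b) * (\<Sum>x\<in>{0..<int q}. unit_root q ((a - b) * x))
        = (if a = b then of_nat q * (c a * cnj (c a)) else 0)"
      using assms(1) by (simp add: sum_unit_root)
  qed
  also have "\<dots> = complex_of_real (real q * (\<Sum>a\<in>A. (norm (c a))\<^sup>2))"
    using fin unfolding of_real_mult of_real_sum complex_norm_square by (simp add: sum_distrib_left)
  finally show ?thesis using of_real_eq_iff by blast
qed

section \<open>Characters modulo a prime and their Gauss sums\<close>

lemma coprime_int_prime_iff: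
  assumes q: "prime q"
  shows "coprime n (int q) \<longleftrightarrow> \<not> int q dvd n"
proof
  assume *: "coprime n (int q)"
  show "\<not> int q dvd n"
  proof
    assume "int q dvd n"
    then have "is_unit (int q)" by (intro coprime_common_divisor[OF *]) auto
    then show False using prime_gt_1_nat[OF q] by simp
  qed
next
  assume "\<not> int q dvd n"
  then have "coprime (int q) n" using q by (intro prime_imp_coprime) auto
  then show "coprime n (int q)" by (simp add: coprime_commute)
qed

context
  fixes q :: nat and chi :: "int \<Rightarrow> complex"
  assumes q: "prime q" and chi: "dirichlet_character q chi"
begin

lemma modulus_pos: "q > 0"
  using q by (simp add: prime_gt_0_nat)

lemma character_add_modulus: "chi (n + int q) = chi n"
  using chi by (simp add: dirichlet_character_def)

lemma character_mult: "chi (m * n) = chi m * chi n"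
  using chi by (simp add: dirichlet_character_def)

lemma character_eq_0_iff: "chi n = 0 \<longleftrightarrow> \<not> coprime n (int q)"
  using chi by (auto simp: dirichlet_character_def)

lemma character_cong: "[m = n] (mod int q) \<Longrightarrow> chi m = chi n"
  using periodic_int_mod[of chi "int q" m, OF character_add_modulus] periodic_int_mod[of chi "int q" n, OF character_add_modulus]
  by (simp add: cong_def)

lemma character_1: "chi 1 = 1"
proof -
  have "chi 1 * (chi 1 - 1) = 0" unfolding right_diff_distrib character_mult[symmetric] by simp
  then show ?thesis using character_eq_0_iff[of 1] by simp
qed

lemma character_power: "chi (n ^ k) = chi n ^ k"
  by (induction k) (simp_all add: character_1 character_mult)

text \<open>By Fermat's theorem the value is a root of unity of order dividing
  \<open>q - 1\<close>.\<close>

lemma norm_character: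
  assumes "coprime n (int q)"
  shows "norm (chi n) = 1"
proof -
  have "\<not> q dvd nat (n mod int q)"
  proof
    assume "q dvd nat (n mod int q)"
    then have "int q dvd n mod int q" using modulus_pos by (simp add: int_dvd_int_iff[symmetric])
    then have "int q dvd n" by (simp add: dvd_mod_iff)
    then have "int q dvd 1" using assms by (intro coprime_common_divisor[OF assms]) auto
    then show False using prime_gt_1_nat[OF q] by simp
  qed
  then have "[nat (n mod int q) ^ (q - 1) = 1] (mod q)" using fermat_theorem q by blast
  then have "[int (nat (n mod int q) ^ (q - 1)) = int 1] (mod int q)" by (simp only: cong_int_iff)
  then have "[(n mod int q) ^ (q - 1) = 1] (mod int q)" using modulus_pos by simp
  then have "[n ^ (q - 1) = 1] (mod int q)" by (simp add: cong_def power_mod)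
  then have "chi (n ^ (q - 1)) = chi 1" by (rule character_cong)
  then have "chi n ^ (q - 1) = 1" by (simp add: character_power character_1)
  then have "norm (chi n) ^ (q - 1) = 1" by (simp flip: norm_power)
  moreover have "q - 1 > 0" using prime_gt_1_nat[OF q] by simp
  ultimately show ?thesis using power_eq_imp_eq_base[of "norm (chi n)" "q - 1" 1] by simp
qed

lemma norm_character_le: "norm (chi n) \<le> 1"
  using norm_character[of n] character_eq_0_iff[of n] by (cases "coprime n (int q)") simp_all

lemma character_mult_cnj: "coprime n (int q) \<Longrightarrow> chi n * cnj (chi n) = 1"
  using norm_character[of n] unfolding complex_norm_square[symmetric] by simp

text \<open>For \<open>n\<close> prime to \<open>q\<close>, substitute \<open>n * a\<close> for
  \<open>a\<close>. For \<open>n\<close> divisible by \<open>q\<close> both sides vanish: the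
  witness \<open>b\<close> says that the character is nonprincipal, so its complete sum is
  0.\<close>

lemma gauss_sum_shift:
  assumes "coprime b (int q)" "chi b \<noteq> 1"
  shows "(\<Sum>a\<in>{0..<int q}. cnj (chi a) * unit_root q (a * n))
       = chi n * (\<Sum>a\<in>{0..<int q}. cnj (chi a) * unit_root q a)"
proof (cases "int q dvd n")
  case True
  have "(\<Sum>a\<in>{0..<int q}. chi (b * a + 0)) = (\<Sum>a\<in>{0..<int q}. chi a)"
    using modulus_pos assms character_add_modulus by (intro sum_periodic_affine) auto
  then have "chi b * (\<Sum>a\<in>{0..<int q}. chi a) = (\<Sum>a\<in>{0..<int q}. chi a)"
    by (simp add: character_mult sum_distrib_left)
  then have "(\<Sum>a\<in>{0..<int q}. chi a) = 0" using assms(2) by auto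
  then have "(\<Sum>a\<in>{0..<int q}. cnj (chi a)) = 0" by (simp flip: cnj_sum)
  moreover have "chi n = 0" using True character_eq_0_iff coprime_int_prime_iff[OF q] by blast
  moreover have "unit_root q (a * n) = 1" for a using True modulus_pos by (intro unit_root_dvd) auto
  ultimately show ?thesis by simp
next
  case False
  then have n: "coprime n (int q)" by (simp add: coprime_int_prime_iff[OF q])
  have "(\<Sum>a\<in>{0..<int q}. cnj (chi (n * a + 0)) * unit_root q (n * a + 0))
      = (\<Sum>a\<in>{0..<int q}. cnj (chi a) * unit_root q a)"
    using modulus_pos n character_add_modulus
    by (intro sum_periodic_affine[of _ "\<lambda>a. cnj (chi a) * unit_root q a"])
       (auto simp: unit_root_add unit_root_dvd)
  then have "cnj (chi n) * (\<Sum>a\<in>{0..<int q}. cnj (chi a) * unit_root q (a * n))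
      = (\<Sum>a\<in>{0..<int q}. cnj (chi a) * unit_root q a)"
    by (simp add: character_mult sum_distrib_left mult_ac)
  then have "chi n * cnj (chi n) * (\<Sum>a\<in>{0..<int q}. cnj (chi a) * unit_root q (a * n))
      = chi n * (\<Sum>a\<in>{0..<int q}. cnj (chi a) * unit_root q a)"
    by (simp add: mult.assoc)
  then show ?thesis using character_mult_cnj[OF n] by simp
qed

lemma sum_norm_character: "(\<Sum>a\<in>{0..<int q}. (norm (chi a))\<^sup>2) = real q - 1"
proof -
  have "{0..<int q} = insert 0 {1..<int q}" using modulus_pos by auto
  moreover have "chi 0 = 0" by (simp add: character_eq_0_iff coprime_int_prime_iff[OF q])
  moreover have "norm (chi a) = 1" if "a \<in> {1..<int q}" for a
    using that zdvd_not_zless[of a "int q"] by (intro norm_character) (auto simp: coprime_int_prime_iff[OF q])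
  ultimately show ?thesis using modulus_pos by simp
qed

text \<open>Parseval for the coefficients \<open>cnj (chi a)\<close>: by
  \<open>gauss_sum_shift\<close> every nonzero residue contributes the same amount, and the common
  factor \<open>q - 1\<close> cancels.\<close>

lemma norm_gauss_sum:
  assumes "coprime b (int q)" "chi b \<noteq> 1"
  shows "(norm (\<Sum>a\<in>{0..<int q}. cnj (chi a) * unit_root q a))\<^sup>2 = real q"
proof -
  define tau where "tau = (\<Sum>a\<in>{0..<int q}. cnj (chi a) * unit_root q a)"
  have "real q * (real q - 1) = (\<Sum>n\<in>{0..<int q}. (norm (\<Sum>a\<in>{0..<int q}. cnj (chi a) * unit_root q (a * n)))\<^sup>2)"
    using modulus_pos by (simp add: parseval_unit_root sum_norm_character)
  also have "\<dots> = (\<Sum>n\<in>{0..<int q}. (norm (chi n))\<^sup>2 * (norm tau)\<^sup>2)"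
    by (simp add: gauss_sum_shift[OF assms] tau_def norm_mult power_mult_distrib)
  also have "\<dots> = (real q - 1) * (norm tau)\<^sup>2"
    by (simp flip: sum_distrib_right add: sum_norm_character)
  finally show ?thesis using prime_gt_1_nat[OF q] unfolding tau_def by simp
qed

end

section \<open>All characters modulo a prime and their orthogonality\<close>

text \<open>The index with respect to a primitive root. It is an arbitrary choice of exponent, well
  defined only modulo \<open>q - 1\<close>, hence the congruences; the last property records the
  index of the primitive root itself.\<close>

lemma exists_discrete_log:
  assumes "prime q"
  obtains ind :: "int \<Rightarrow> nat"
  where "\<And>m n. coprime m (int q) \<Longrightarrow> coprime n (int q) \<Longrightarrow>
      [int (ind (m * n)) = int (ind m) + int (ind n)] (mod int (q - 1))"
    and "\<And>m n. coprime m (int q) \<Longrightarrow> coprime n (int q) \<Longrightarrow>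
      [int (ind m) = int (ind n)] (mod int (q - 1)) \<longleftrightarrow> [m = n] (mod int q)"
    and "\<exists>g. coprime g (int q) \<and> [int (ind g) = 1] (mod int (q - 1))"
proof -
  have q: "q > 1" using assms by (rule prime_gt_1_nat)
  obtain g where g: "residue_primroot q g"
    using prime_primitive_root_exists[OF q assms] by blast
  then have cop: "coprime q g" and ord: "ord q g = q - 1"
    using assms by (simp_all add: residue_primroot_def totient_prime)
  have ex: "\<exists>i. [n = int (g ^ i)] (mod int q)" if "coprime n (int q)" for n
  proof -
    have "coprime (nat (n mod int q)) q"
    proof -
      have "coprime (int (nat (n mod int q))) (int q)" using that q by simp
      then show ?thesis by (simp only: coprime_int_iff)
    qed
    moreover have "nat (n mod int q) \<noteq> 0"
    proof
      assume "nat (n mod int q) = 0"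
      then have "coprime 0 q" using calculation by simp
      then show False using q by simp
    qed
    moreover have "nat (n mod int q) \<le> q"
      using q pos_mod_bound[of "int q" n] by linarith
    ultimately have "nat (n mod int q) \<in> totatives q" by (simp add: in_totatives_iff)
    then obtain i where "nat (n mod int q) = g ^ i mod q"
      using residue_primroot_is_generator[OF q g] by (auto simp: bij_betw_def image_iff)
    then have "int (nat (n mod int q)) = int (g ^ i) mod int q" by (simp only: of_nat_mod)
    then have "[n = int (g ^ i)] (mod int q)" using q by (simp add: cong_def)
    then show ?thesis by blast
  qed
  define ind where "ind = (\<lambda>n. SOME i. [n = int (g ^ i)] (mod int q))"
  have ind: "[n = int (g ^ ind n)] (mod int q)" if "coprime n (int q)" for n
    unfolding ind_def using ex[OF that] by (rule someI_ex)
  have pow: "[int (g ^ a) = int (g ^ b)] (mod int q) \<longleftrightarrow> [int a = int b] (mod int (q - 1))" for a b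
    using order_divides_expdiff[OF cop, of a b] ord by (simp only: cong_int_iff)
  show ?thesis
  proof
    fix m n assume mn: "coprime m (int q)" "coprime n (int q)"
    have "[int (g ^ ind (m * n)) = m * n] (mod int q)"
      using ind[of "m * n"] mn by (simp only: cong_sym_eq[of "m * n"] coprime_mult_left_iff)
    also have "[m * n = int (g ^ ind m) * int (g ^ ind n)] (mod int q)"
      using ind mn by (intro cong_mult)
    also have "int (g ^ ind m) * int (g ^ ind n) = int (g ^ (ind m + ind n))"
      by (simp add: power_add)
    finally have "[int (ind (m * n)) = int (ind m + ind n)] (mod int (q - 1))"
      unfolding pow .
    then show "[int (ind (m * n)) = int (ind m) + int (ind n)] (mod int (q - 1))"
      by simp
    show "[int (ind m) = int (ind n)] (mod int (q - 1)) \<longleftrightarrow> [m = n] (mod int q)"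
      unfolding pow[symmetric] using ind[OF mn(1)] ind[OF mn(2)]
      by (meson cong_sym cong_trans)
  next
    have c: "coprime (int g) (int q)" using cop by (simp add: coprime_commute)
    have "[int (g ^ ind (int g)) = int (g ^ 1)] (mod int q)"
      using ind[OF c] by (simp add: cong_sym_eq)
    then show "\<exists>g. coprime g (int q) \<and> [int (ind g) = 1] (mod int (q - 1))"
      unfolding pow using c by (intro exI[of _ "int g"]) simp
  qed
qed

text \<open>The character number \<open>j\<close> sends \<open>n\<close> to
  \<open>e(j * ind n / (q - 1))\<close>. Orthogonality is then a complete sum of roots of unity over
  \<open>j\<close>, and an element of index 1 detects which characters are real.\<close>

lemma exists_character_family:
  assumes q: "prime q" "q > 2"
  obtains X :: "int \<Rightarrow> int \<Rightarrow> complex"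
  where "\<And>j. dirichlet_character q (X j)"
    and "\<And>m n. coprime m (int q) \<Longrightarrow> coprime n (int q) \<Longrightarrow>
      (\<Sum>j\<in>{0..<int (q - 1)}. X j m * cnj (X j n)) = (if [m = n] (mod int q) then of_nat (q - 1) else 0)"
    and "card {j\<in>{0..<int (q - 1)}. real_character (X j)} \<le> 2"
proof -
  obtain ind where mult: "\<And>m n. coprime m (int q) \<Longrightarrow> coprime n (int q) \<Longrightarrow>
      [int (ind (m * n)) = int (ind m) + int (ind n)] (mod int (q - 1))"
    and eq: "\<And>m n. coprime m (int q) \<Longrightarrow> coprime n (int q) \<Longrightarrow>
      [int (ind m) = int (ind n)] (mod int (q - 1)) \<longleftrightarrow> [m = n] (mod int q)"
    and gen: "\<exists>g. coprime g (int q) \<and> [int (ind g) = 1] (mod int (q - 1))"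
    using exists_discrete_log[OF q(1)] by blast
  define X where "X = (\<lambda>j n. if coprime n (int q) then unit_root (q - 1) (j * int (ind n)) else 0)"
  have q1: "q - 1 > 0" using q by simp
  have nz: "unit_root (q - 1) k \<noteq> 0" for k
    using norm_unit_root[of "q - 1" k] by (metis norm_zero zero_neq_one)
  show ?thesis
  proof
    fix j
    have shift: "coprime (n + int q) (int q) \<longleftrightarrow> coprime n (int q)" for n
      by (simp add: coprime_iff_gcd_eq_1)
    have "X j (n + int q) = X j n" for n
    proof (cases "coprime n (int q)")
      case True
      moreover from this have c: "coprime (n + int q) (int q)" by (simp add: shift)
      moreover have "[int (ind (n + int q)) = int (ind n)] (mod int (q - 1))"
        using eq[OF c True] by (simp add: cong_def)
      then have "unit_root (q - 1) (j * int (ind (n + int q))) = unit_root (q - 1) (j * int (ind n))"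
        by (intro unit_root_cong[OF q1] cong_scalar_left)
      ultimately show ?thesis by (simp add: X_def)
    qed (simp add: X_def shift)
    moreover have "X j (m * n) = X j m * X j n" for m n
    proof (cases "coprime m (int q) \<and> coprime n (int q)")
      case True
      then have "[int (ind (m * n)) = int (ind m) + int (ind n)] (mod int (q - 1))"
        using mult by blast
      then have "unit_root (q - 1) (j * int (ind (m * n))) = unit_root (q - 1) (j * (int (ind m) + int (ind n)))"
        by (intro unit_root_cong[OF q1] cong_scalar_left)
      then show ?thesis using True by (simp add: X_def distrib_left unit_root_add)
    qed (auto simp: X_def)
    moreover have "X j n \<noteq> 0 \<longleftrightarrow> coprime n (int q)" for n
      using nz by (simp add: X_def)
    ultimately show "dirichlet_character q (X j)"
      using q by (simp add: dirichlet_character_def)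
  next
    fix m n assume mn: "coprime m (int q)" "coprime n (int q)"
    have "(\<Sum>j\<in>{0..<int (q - 1)}. X j m * cnj (X j n))
        = (\<Sum>j\<in>{0..<int (q - 1)}. unit_root (q - 1) ((int (ind m) - int (ind n)) * j))"
    proof (intro sum.cong refl)
      fix j
      have "unit_root (q - 1) ((int (ind m) - int (ind n)) * j)
          = unit_root (q - 1) (j * int (ind m) + - (j * int (ind n)))"
        by (simp add: algebra_simps)
      then show "X j m * cnj (X j n) = unit_root (q - 1) ((int (ind m) - int (ind n)) * j)"
        using mn by (simp only: X_def unit_root_add unit_root_minus if_True)
    qed
    also have "\<dots> = (if int (q - 1) dvd int (ind m) - int (ind n) then of_nat (q - 1) else 0)"
      by (rule sum_unit_root[OF q1])
    also have "int (q - 1) dvd int (ind m) - int (ind n) \<longleftrightarrow> [m = n] (mod int q)"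
      using eq[OF mn] by (simp only: cong_iff_dvd_diff)
    finally show "(\<Sum>j\<in>{0..<int (q - 1)}. X j m * cnj (X j n))
        = (if [m = n] (mod int q) then of_nat (q - 1) else 0)" .
  next
    obtain g where g: "coprime g (int q)" "[int (ind g) = 1] (mod int (q - 1))"
      using gen by blast
    have "{j\<in>{0..<int (q - 1)}. real_character (X j)} \<subseteq> {0, int (q - 1) div 2}"
    proof
      fix j assume "j \<in> {j\<in>{0..<int (q - 1)}. real_character (X j)}"
      then have j: "0 \<le> j" "j < int (q - 1)" "X j g \<in> \<real>"
        by (auto simp: real_character_def)
      have "unit_root (q - 1) (j * int (ind g)) = unit_root (q - 1) (j * 1)"
        using g by (intro unit_root_cong[OF q1] cong_scalar_left)
      then have Xg: "X j g = unit_root (q - 1) j" using g by (simp add: X_def)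
      then have "cnj (unit_root (q - 1) j) = unit_root (q - 1) j"
        using j by (simp add: Reals_cnj_iff)
      \<comment> \<open>A real number of modulus 1 has square 1. So \<open>q - 1\<close> divides
        \<open>2 * j\<close>, and the range of \<open>j\<close> leaves only two
        possibilities.\<close>
      then have "unit_root (q - 1) (j + j) = unit_root (q - 1) j * cnj (unit_root (q - 1) j)"
        by (simp only: unit_root_add)
      also have "\<dots> = 1" unfolding complex_norm_square[symmetric] by simp
      finally have "int (q - 1) dvd j + j" by (simp only: unit_root_eq_1_iff[OF q1])
      then obtain k where k: "j + j = int (q - 1) * k" by auto
      have "int (q - 1) * k < int (q - 1) * 2" "0 \<le> int (q - 1) * k" using j k by linarith+
      then have "k < 2" "0 \<le> k"
        using q1 mult_less_cancel_left_pos[of "int (q - 1)" k 2] by (simp_all only: zero_le_mult_iff) auto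
      then have "k = 0 \<or> k = 1" by auto
      then show "j \<in> {0, int (q - 1) div 2}" using k by auto
    qed
    then have "card {j\<in>{0..<int (q - 1)}. real_character (X j)} \<le> card {0, int (q - 1) div 2}"
      by (intro card_mono) auto
    also have "\<dots> \<le> 2" by (simp add: card_insert_if)
    finally show "card {j\<in>{0..<int (q - 1)}. real_character (X j)} \<le> 2" .
  qed
qed

section \<open>Character sums over intervals\<close>

text \<open>The Fourier transform of the indicator of \<open>{1..N}\<close> on the residues modulo
  \<open>q\<close>, called \<open>E(a)\<close> in the overview.\<close>

definition interval_exp_sum :: "nat \<Rightarrow> int \<Rightarrow> int \<Rightarrow> complex" where
  "interval_exp_sum q N a = (\<Sum>h\<in>{1..N}. unit_root q (h * a))"

text \<open>Parseval with exchanged roles: \<open>h\<close> is the frequency and \<open>a\<close>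
  the variable running over all residues.\<close>

lemma sum_norm_interval_exp_sum:
  assumes "0 < N" "N < int q"
  shows "(\<Sum>a\<in>{0..<int q}. (norm (interval_exp_sum q N a))\<^sup>2) = real q * of_int N"
proof -
  have "q > 0" using assms by simp
  moreover have "{1..N} \<subseteq> {0..<int q}" using assms by auto
  ultimately show ?thesis
    using parseval_unit_root[of q "{1..N}" "\<lambda>_. 1"] assms by (simp add: interval_exp_sum_def)
qed

text \<open>All angles stay within \<open>[0, pi/3]\<close>, so every term has real part at least
  \<open>1/2\<close> and no cancellation occurs.\<close>

lemma norm_interval_exp_sum_ge:
  assumes "0 \<le> a" "6 * N * a \<le> int q" "0 < N" "q > 0"
  shows "(of_int N)\<^sup>2 / 4 \<le> (norm (interval_exp_sum q N a))\<^sup>2"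
proof -
  have "1 / 2 \<le> Re (unit_root q (h * a))" if h: "h \<in> {1..N}" for h
  proof -
    have "6 * (h * a) \<le> 6 * (N * a)" using h assms by (intro mult_left_mono mult_right_mono) auto
    also have "\<dots> \<le> int q" using assms by simp
    finally have "real_of_int (6 * (h * a)) \<le> real_of_int (int q)" by (simp only: of_int_le_iff)
    then have *: "real_of_int (h * a) / real q \<le> 1 / 6" using assms by (simp add: field_simps)
    have "2 * pi * (real_of_int (h * a) / real q) \<le> 2 * pi * (1 / 6)"
      using * by (intro mult_left_mono) auto
    then have le: "2 * pi * real_of_int (h * a) / real q \<le> pi / 3" by simp
    have ge: "0 \<le> 2 * pi * real_of_int (h * a) / real q"
      using h assms by simp
    have "cos (pi / 3) \<le> cos (2 * pi * real_of_int (h * a) / real q)"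
      using le ge by (intro cos_monotone_0_pi_le) auto
    then show ?thesis by (simp add: unit_root_def cos_60)
  qed
  then have "(\<Sum>h\<in>{1..N}. 1 / 2) \<le> (\<Sum>h\<in>{1..N}. Re (unit_root q (h * a)))"
    by (intro sum_mono)
  then have "of_int N / 2 \<le> Re (interval_exp_sum q N a)"
    using assms by (simp add: interval_exp_sum_def)
  also have "\<dots> \<le> norm (interval_exp_sum q N a)" by (rule complex_Re_le_cmod)
  finally have "(of_int N / 2)\<^sup>2 \<le> (norm (interval_exp_sum q N a))\<^sup>2"
    using assms by (intro power_mono) auto
  then show ?thesis by (simp add: power_divide)
qed

definition interval_char_sum :: "(int \<Rightarrow> complex) \<Rightarrow> int \<Rightarrow> int \<Rightarrow> complex" where
  "interval_char_sum chi N x = (\<Sum>h\<in>{1..N}. chi (x + h))"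

text \<open>Since \<open>x\<close> is an integer, only the integer part of \<open>H\<close> matters.
  The range of \<open>h\<close> no longer depends on \<open>x\<close>, as the Fourier expansion
  requires.\<close>

lemma short_char_sum_eq: "short_char_sum chi H x = interval_char_sum chi \<lfloor>H\<rfloor> x"
  unfolding short_char_sum_altdef interval_char_sum_def
  by (rule sum.reindex_bij_witness[of _ "\<lambda>h. x + h" "\<lambda>n. n - x"]) auto

lemma nonreal_nonprincipal:
  assumes "prime q" "dirichlet_character q chi" "\<not> real_character chi"
  obtains b where "coprime b (int q)" "chi b \<noteq> 1"
proof -
  obtain b where "chi b \<notin> \<real>" using assms by (auto simp: real_character_def)
  then have "chi b \<noteq> 0" "chi b \<noteq> 1" by auto
  then show ?thesis using that character_eq_0_iff[OF assms(1,2)] by blast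
qed

text \<open>Each \<open>chi (x + h)\<close> is expanded by \<open>gauss_sum_shift\<close>; summing
  over \<open>h\<close> first produces \<open>interval_exp_sum\<close>. The Gauss sum is kept as a
  factor on the left, since only its modulus is needed later.\<close>

lemma interval_char_sum_expansion:
  assumes "prime q" "dirichlet_character q chi" "\<not> real_character chi"
  obtains tau where "(norm tau)\<^sup>2 = real q"
    "\<And>x. tau * interval_char_sum chi N x =
      (\<Sum>a\<in>{0..<int q}. cnj (chi a) * interval_exp_sum q N a * unit_root q (a * x))"
proof -
  obtain b where b: "coprime b (int q)" "chi b \<noteq> 1"
    using nonreal_nonprincipal assms by blast
  define tau where "tau = (\<Sum>a\<in>{0..<int q}. cnj (chi a) * unit_root q a)"
  have "tau * interval_char_sum chi N x =
      (\<Sum>a\<in>{0..<int q}. cnj (chi a) * interval_exp_sum q N a * unit_root q (a * x))" for x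
  proof -
    have "tau * interval_char_sum chi N x = (\<Sum>h\<in>{1..N}. chi (x + h) * tau)"
      by (simp add: interval_char_sum_def sum_distrib_left mult.commute)
    also have "\<dots> = (\<Sum>h\<in>{1..N}. \<Sum>a\<in>{0..<int q}. cnj (chi a) * unit_root q (a * (x + h)))"
      unfolding tau_def gauss_sum_shift[OF assms(1,2) b] ..
    also have "\<dots> = (\<Sum>a\<in>{0..<int q}. \<Sum>h\<in>{1..N}. cnj (chi a) * unit_root q (h * a) * unit_root q (a * x))"
      by (subst sum.swap) (simp add: distrib_left unit_root_add mult_ac)
    finally show ?thesis by (simp add: interval_exp_sum_def sum_distrib_left sum_distrib_right)
  qed
  then show ?thesis
    using that norm_gauss_sum[OF assms(1,2) b] unfolding tau_def by blast
qed

lemma sum_norm_interval_char_sum_le: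
  assumes "prime q" "dirichlet_character q chi" "\<not> real_character chi" "0 < N" "N < int q"
  shows "(\<Sum>x\<in>{0..<int q}. (norm (interval_char_sum chi N x))\<^sup>2) \<le> real q * of_int N"
proof -
  have q: "q > 0" using assms by simp
  obtain tau where tau: "(norm tau)\<^sup>2 = real q"
    "\<And>x. tau * interval_char_sum chi N x =
      (\<Sum>a\<in>{0..<int q}. cnj (chi a) * interval_exp_sum q N a * unit_root q (a * x))"
    using interval_char_sum_expansion[OF assms(1-3)] by blast
  have "real q * (\<Sum>x\<in>{0..<int q}. (norm (interval_char_sum chi N x))\<^sup>2)
      = (\<Sum>x\<in>{0..<int q}. (norm (tau * interval_char_sum chi N x))\<^sup>2)"
    by (simp add: norm_mult power_mult_distrib tau(1) sum_distrib_left)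
  also have "\<dots> = real q * (\<Sum>a\<in>{0..<int q}. (norm (cnj (chi a) * interval_exp_sum q N a))\<^sup>2)"
    unfolding tau(2) using q by (intro parseval_unit_root) auto
  also have "(\<Sum>a\<in>{0..<int q}. (norm (cnj (chi a) * interval_exp_sum q N a))\<^sup>2)
      \<le> (\<Sum>a\<in>{0..<int q}. (norm (interval_exp_sum q N a))\<^sup>2)"
  proof (intro sum_mono power_mono)
    fix a
    show "norm (cnj (chi a) * interval_exp_sum q N a) \<le> norm (interval_exp_sum q N a)"
      using norm_character_le[OF assms(1,2), of a] by (simp add: norm_mult mult_left_le_one_le)
  qed auto
  also have "\<dots> = real q * of_int N" using assms by (intro sum_norm_interval_exp_sum)
  finally show ?thesis using q by simp
qed

text \<open>Averaging the character sum over the points \<open>-k\<close> completes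
  \<open>E(a)\<close> to \<open>|E(a)|^2\<close> on the Fourier side. Cauchy-Schwarz over these
  \<open>N\<close> points and periodicity turn this into a lower bound for the mass near the right
  end.\<close>

lemma sum_norm_interval_char_sum_ge:
  assumes "prime q" "dirichlet_character q chi" "\<not> real_character chi" "0 < N" "N < int q"
  shows "(norm (\<Sum>a\<in>{0..<int q}. cnj (chi a) * complex_of_real ((norm (interval_exp_sum q N a))\<^sup>2)))\<^sup>2
     \<le> real q * of_int N * (\<Sum>x\<in>{int q - N..<int q}. (norm (interval_char_sum chi N x))\<^sup>2)"
proof -
  obtain tau where tau: "(norm tau)\<^sup>2 = real q"
    "\<And>x. tau * interval_char_sum chi N x =
      (\<Sum>a\<in>{0..<int q}. cnj (chi a) * interval_exp_sum q N a * unit_root q (a * x))"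
    using interval_char_sum_expansion[OF assms(1-3)] by blast
  let ?S = "interval_char_sum chi N" and ?E = "interval_exp_sum q N"
  have cnj_E: "cnj (?E a) = (\<Sum>k\<in>{1..N}. unit_root q (- (k * a)))" for a
    by (simp add: interval_exp_sum_def unit_root_minus)
  \<comment> \<open>Evaluation at \<open>-k\<close> brings in \<open>e(-k * a / q)\<close>, and the
    sum of these over \<open>k\<close> is the conjugate of \<open>E(a)\<close>.\<close>
  have "tau * (\<Sum>k\<in>{1..N}. ?S (- k))
      = (\<Sum>k\<in>{1..N}. \<Sum>a\<in>{0..<int q}. cnj (chi a) * ?E a * unit_root q (- (k * a)))"
    by (simp add: sum_distrib_left tau(2) mult.commute)
  also have "\<dots> = (\<Sum>a\<in>{0..<int q}. cnj (chi a) * (?E a * cnj (?E a)))"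
    by (subst sum.swap) (simp add: cnj_E sum_distrib_left mult.assoc)
  also have "\<dots> = (\<Sum>a\<in>{0..<int q}. cnj (chi a) * complex_of_real ((norm (?E a))\<^sup>2))"
    by (simp only: complex_norm_square)
  finally have eq: "(\<Sum>a\<in>{0..<int q}. cnj (chi a) * complex_of_real ((norm (?E a))\<^sup>2))
      = tau * (\<Sum>k\<in>{1..N}. ?S (- k))" by simp
  have "(norm (\<Sum>k\<in>{1..N}. ?S (- k)))\<^sup>2 \<le> (\<Sum>k\<in>{1..N}. norm (?S (- k)))\<^sup>2"
    by (intro power_mono norm_sum) auto
  also have "\<dots> \<le> of_int N * (\<Sum>k\<in>{1..N}. (norm (?S (- k)))\<^sup>2)"
    using sum_squared_le_sum_of_squares[where I = "{1..N}" and f = "\<lambda>k. norm (?S (- k))"] assms by (simp add: mult.commute)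
  also have "(\<Sum>k\<in>{1..N}. (norm (?S (- k)))\<^sup>2) = (\<Sum>x\<in>{int q - N..<int q}. (norm (?S x))\<^sup>2)"
  proof (rule sum.reindex_bij_witness[of _ "\<lambda>x. int q - x" "\<lambda>k. int q - k"])
    fix k assume "k \<in> {1..N}"
    have "?S (int q - k) = ?S (- k)"
      unfolding interval_char_sum_def
    proof (intro sum.cong refl)
      fix h
      show "chi (int q - k + h) = chi (- k + h)"
        using character_add_modulus[OF assms(1,2), of "- k + h"] by (simp add: algebra_simps)
    qed
    then show "(norm (?S (int q - k)))\<^sup>2 = (norm (?S (- k)))\<^sup>2" by simp
  qed auto
  finally have "(norm tau)\<^sup>2 * (norm (\<Sum>k\<in>{1..N}. ?S (- k)))\<^sup>2
      \<le> real q * (of_int N * (\<Sum>x\<in>{int q - N..<int q}. (norm (?S x))\<^sup>2))"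
    unfolding tau(1) by (intro mult_left_mono) auto
  then show ?thesis unfolding eq by (simp add: norm_mult power_mult_distrib mult.assoc)
qed

section \<open>Resonance\<close>

text \<open>The characters are weighted by the square of a Dirichlet polynomial supported on \<open>B\<close>; all terms
  surviving the orthogonality relations are nonnegative, so only the contribution of \<open>G\<close> has to be kept.
  Real characters are harmless because there are at most two of them.\<close>

lemma resonance:
  fixes B G :: "nat set" and w :: "int \<Rightarrow> real" and W T :: real
  assumes q: "prime q" "q > 2"
    and B: "B \<noteq> {}" "B \<subseteq> {1..<q}" and G: "G \<subseteq> {1..<q}"
    and w: "\<And>a. 0 \<le> w a" and W: "0 \<le> W" "\<And>a. a \<in> G \<Longrightarrow> W \<le> w (int a)"
    and inv: "\<And>a. a \<in> G \<Longrightarrow> card B \<le> 2 * card {n\<in>B. a * n \<in> B}"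
    and T: "0 \<le> T" "T < card G * W / 2 - 2 * card B * (\<Sum>a\<in>{0..<int q}. w a) / (real q - 1)"
  shows "\<exists>chi. dirichlet_character q chi \<and> \<not> real_character chi \<and>
    T < norm (\<Sum>a\<in>{0..<int q}. cnj (chi a) * complex_of_real (w a))"
proof (rule ccontr)
  assume neg: "\<not> ?thesis"
  then have small: "norm (\<Sum>a\<in>{0..<int q}. cnj (chi a) * complex_of_real (w a)) \<le> T"
    if "dirichlet_character q chi" "\<not> real_character chi" for chi
    using that neg by (meson not_le)
  obtain X :: "int \<Rightarrow> int \<Rightarrow> complex" where X: "\<And>j. dirichlet_character q (X j)"
    and orth: "\<And>m n. coprime m (int q) \<Longrightarrow> coprime n (int q) \<Longrightarrow>
      (\<Sum>j\<in>{0..<int (q - 1)}. X j m * cnj (X j n)) = (if [m = n] (mod int q) then of_nat (q - 1) else 0)"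
    and real_card: "card {j\<in>{0..<int (q - 1)}. real_character (X j)} \<le> 2"
    using exists_character_family[OF q] by blast
  define J where "J = {0..<int (q - 1)}"
  define V where "V = (\<Sum>a\<in>{0..<int q}. w a)"
  define R where "R = (\<lambda>j. \<Sum>n\<in>B. X j (int n))"
  define Tj where "Tj = (\<lambda>j. \<Sum>a\<in>{0..<int q}. cnj (X j a) * complex_of_real (w a))"
  have finB: "finite B" using B finite_subset by blast
  have finG: "finite G" using G finite_subset by blast
  have finJ: "finite J" by (simp add: J_def)
  have B0: "card B > 0" using B finB by (simp add: card_gt_0_iff)
  have V0: "V \<ge> 0" unfolding V_def using w by (intro sum_nonneg) auto
  have cop: "coprime (int n) (int q)" if "n \<in> {1..<q}" for n
  proof -
    have "\<not> q dvd n" using that nat_dvd_not_less[of n q] by auto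
    then show ?thesis by (simp add: coprime_int_prime_iff[OF q(1)])
  qed
  have cong_iff: "[int m = int n] (mod int q) \<longleftrightarrow> m = n" if "m \<in> {1..<q}" "n \<in> {1..<q}" for m n
    using that by (auto simp: cong_int_iff cong_def)

  have normR: "complex_of_real ((norm (R j))\<^sup>2) = (\<Sum>m\<in>B. \<Sum>n\<in>B. X j (int m) * cnj (X j (int n)))" for j
    unfolding complex_norm_square R_def cnj_sum sum_product ..

  \<comment> \<open>The total resonator weight: elements of \<open>B\<close> lie below
    \<open>q\<close>, so congruent ones are equal and only the diagonal survives.\<close>
  have sumR: "(\<Sum>j\<in>J. (norm (R j))\<^sup>2) = (real q - 1) * card B"
  proof -
    have "complex_of_real (\<Sum>j\<in>J. (norm (R j))\<^sup>2)
        = (\<Sum>j\<in>J. \<Sum>m\<in>B. \<Sum>n\<in>B. X j (int m) * cnj (X j (int n)))"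
      unfolding of_real_sum normR ..
    also have "\<dots> = (\<Sum>m\<in>B. \<Sum>n\<in>B. \<Sum>j\<in>J. X j (int m) * cnj (X j (int n)))"
      by (subst sum.swap, rule sum.cong[OF refl], rule sum.swap)
    also have "\<dots> = (\<Sum>m\<in>B. \<Sum>n\<in>B. if m = n then of_nat (q - 1) else 0)"
    proof (intro sum.cong refl)
      fix m n assume "m \<in> B" "n \<in> B"
      then have "m \<in> {1..<q}" "n \<in> {1..<q}" using B by auto
      then show "(\<Sum>j\<in>J. X j (int m) * cnj (X j (int n))) = (if m = n then of_nat (q - 1) else 0)"
        unfolding J_def using orth[OF cop cop] cong_iff by simp
    qed
    also have "\<dots> = complex_of_real ((real q - 1) * card B)"
      using finB q by (simp add: of_nat_diff mult.commute)
    finally show ?thesis by (simp only: of_real_eq_iff)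
  qed

  \<comment> \<open>The contribution of the triple \<open>m\<close>, \<open>n\<close>,
    \<open>a\<close> after summing over all characters: orthogonality keeps exactly the solutions of
    the congruence.\<close>
  define f where "f = (\<lambda>m n a. if coprime a (int q) \<and> [int m = int n * a] (mod int q) then (real q - 1) * w a else 0)"
  have total: "(\<Sum>j\<in>J. complex_of_real ((norm (R j))\<^sup>2) * Tj j)
      = complex_of_real (\<Sum>a\<in>{0..<int q}. \<Sum>m\<in>B. \<Sum>n\<in>B. f m n a)"
  proof -
    have "(\<Sum>j\<in>J. complex_of_real ((norm (R j))\<^sup>2) * Tj j)
        = (\<Sum>j\<in>J. \<Sum>a\<in>{0..<int q}. \<Sum>m\<in>B. \<Sum>n\<in>B.
            complex_of_real (w a) * (X j (int m) * cnj (X j (int n * a))))"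
    proof (intro sum.cong refl)
      fix j
      have "complex_of_real ((norm (R j))\<^sup>2) * Tj j
          = (\<Sum>a\<in>{0..<int q}. (\<Sum>m\<in>B. \<Sum>n\<in>B. X j (int m) * cnj (X j (int n))) * (cnj (X j a) * complex_of_real (w a)))"
        unfolding normR Tj_def by (rule sum_distrib_left)
      also have "\<dots> = (\<Sum>a\<in>{0..<int q}. \<Sum>m\<in>B. \<Sum>n\<in>B.
            complex_of_real (w a) * (X j (int m) * cnj (X j (int n * a))))"
        unfolding sum_distrib_right by (simp add: character_mult[OF q(1) X] mult_ac)
      finally show "complex_of_real ((norm (R j))\<^sup>2) * Tj j
          = (\<Sum>a\<in>{0..<int q}. \<Sum>m\<in>B. \<Sum>n\<in>B.
            complex_of_real (w a) * (X j (int m) * cnj (X j (int n * a))))" .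
    qed
    also have "\<dots> = (\<Sum>a\<in>{0..<int q}. \<Sum>m\<in>B. \<Sum>n\<in>B.
            complex_of_real (w a) * (\<Sum>j\<in>J. X j (int m) * cnj (X j (int n * a))))"
      unfolding sum_distrib_left
      by (subst sum.swap, rule sum.cong[OF refl], subst sum.swap, rule sum.cong[OF refl], rule sum.swap)
    also have "\<dots> = (\<Sum>a\<in>{0..<int q}. \<Sum>m\<in>B. \<Sum>n\<in>B. complex_of_real (f m n a))"
    proof (intro sum.cong refl)
      fix a m n assume "m \<in> B" "n \<in> B"
      then have mn: "m \<in> {1..<q}" "n \<in> {1..<q}" using B by auto
      show "complex_of_real (w a) * (\<Sum>j\<in>J. X j (int m) * cnj (X j (int n * a))) = complex_of_real (f m n a)"
      proof (cases "coprime a (int q)")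
        case True
        then have "coprime (int n * a) (int q)" using cop[OF mn(2)] by simp
        from orth[OF cop[OF mn(1)] this] show ?thesis
          unfolding J_def f_def using True q by (auto simp: of_nat_diff)
      next
        case False
        then have "X j a = 0" for j using character_eq_0_iff[OF q(1) X] by blast
        then show ?thesis using False by (simp add: f_def character_mult[OF q(1) X])
      qed
    qed
    finally show ?thesis by simp
  qed

  have f0: "f m n a \<ge> 0" for m n a using w q by (simp add: f_def)
  have "(real q - 1) * (card G * W * card B / 2) = (\<Sum>a\<in>G. (real q - 1) * W * (card B / 2))"
    by simp
  also have "\<dots> \<le> (\<Sum>a\<in>G. \<Sum>m\<in>B. \<Sum>n\<in>B. f m n (int a))"
  proof (intro sum_mono)
    fix a assume a: "a \<in> G"
    \<comment> \<open>Each such \<open>n\<close> yields the solution with \<open>m = a * n\<close>,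
      an equality and not merely a congruence; near-invariance of \<open>B\<close> provides at least
      \<open>card B / 2\<close> of them.\<close>
    let ?S = "{n\<in>B. a * n \<in> B}"
    have "(real q - 1) * W * (card B / 2) \<le> (real q - 1) * W * card ?S"
      using inv[OF a] W q by (intro mult_left_mono) auto
    also have "\<dots> = (\<Sum>n\<in>?S. (real q - 1) * W)" by simp
    also have "\<dots> \<le> (\<Sum>n\<in>?S. f (a * n) n (int a))"
    proof (intro sum_mono)
      fix n assume "n \<in> ?S"
      have "coprime (int a) (int q)" using a G cop by blast
      then show "(real q - 1) * W \<le> f (a * n) n (int a)"
        using W(2)[OF a] q by (simp add: f_def mult.commute mult_left_mono)
    qed
    also have "\<dots> \<le> (\<Sum>n\<in>?S. \<Sum>m\<in>B. f m n (int a))"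
      using finB f0 by (intro sum_mono member_le_sum) auto
    also have "\<dots> \<le> (\<Sum>n\<in>B. \<Sum>m\<in>B. f m n (int a))"
      using finB f0 by (intro sum_mono2 sum_nonneg) auto
    also have "\<dots> = (\<Sum>m\<in>B. \<Sum>n\<in>B. f m n (int a))" by (rule sum.swap)
    finally show "(real q - 1) * W * (card B / 2) \<le> (\<Sum>m\<in>B. \<Sum>n\<in>B. f m n (int a))" .
  qed
  also have "\<dots> = (\<Sum>a\<in>int ` G. \<Sum>m\<in>B. \<Sum>n\<in>B. f m n a)"
    by (subst sum.reindex) auto
  also have "\<dots> \<le> (\<Sum>a\<in>{0..<int q}. \<Sum>m\<in>B. \<Sum>n\<in>B. f m n a)"
    using G f0 by (intro sum_mono2 sum_nonneg) auto
  also have "\<dots> \<le> norm (\<Sum>j\<in>J. complex_of_real ((norm (R j))\<^sup>2) * Tj j)"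
    unfolding total norm_of_real by (rule abs_ge_self)
  also have "\<dots> \<le> (\<Sum>j\<in>J. (norm (R j))\<^sup>2 * norm (Tj j))"
    by (rule order.trans[OF norm_sum]) (simp add: norm_mult norm_power)
  also have "\<dots> \<le> (\<Sum>j\<in>J. (norm (R j))\<^sup>2 * T + (if real_character (X j) then (real (card B))\<^sup>2 * V else 0))"
  proof (intro sum_mono)
    fix j
    show "(norm (R j))\<^sup>2 * norm (Tj j)
        \<le> (norm (R j))\<^sup>2 * T + (if real_character (X j) then (real (card B))\<^sup>2 * V else 0)"
    proof (cases "real_character (X j)")
      case False
      then have "norm (Tj j) \<le> T" unfolding Tj_def using small X by blast
      then show ?thesis using False by (simp add: mult_left_mono)
    next
      case True
      \<comment> \<open>For a real character everything is bounded trivially. Two such terms of size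
        \<open>(card B)^2 * V\<close>, compared with the total weight
        \<open>(q - 1) * card B\<close>, give the error term in the hypothesis on
        \<open>T\<close>.\<close>
      have "norm (R j) \<le> (\<Sum>n\<in>B. norm (X j (int n)))" unfolding R_def by (rule norm_sum)
      also have "\<dots> \<le> (\<Sum>n\<in>B. 1)" using norm_character_le[OF q(1) X] by (intro sum_mono)
      finally have 1: "(norm (R j))\<^sup>2 \<le> (real (card B))\<^sup>2" by (intro power_mono) auto
      have "norm (Tj j) \<le> (\<Sum>a\<in>{0..<int q}. norm (cnj (X j a) * complex_of_real (w a)))"
        unfolding Tj_def by (rule norm_sum)
      also have "\<dots> \<le> V"
        unfolding V_def using norm_character_le[OF q(1) X] w
        by (intro sum_mono) (simp add: norm_mult mult_left_le_one_le)
      finally have 2: "norm (Tj j) \<le> V" .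
      have "(norm (R j))\<^sup>2 * norm (Tj j) \<le> (real (card B))\<^sup>2 * V"
        using 1 2 by (intro mult_mono) auto
      moreover have "0 \<le> (norm (R j))\<^sup>2 * T" using T by simp
      ultimately show ?thesis using True by simp
    qed
  qed
  also have "\<dots> = (\<Sum>j\<in>J. (norm (R j))\<^sup>2) * T + (\<Sum>j | j \<in> J \<and> real_character (X j). (real (card B))\<^sup>2 * V)"
    by (simp only: sum.distrib sum_distrib_right sum.inter_filter[OF finJ])
  also have "\<dots> \<le> (real q - 1) * card B * T + 2 * ((real (card B))\<^sup>2 * V)"
  proof -
    have "real (card {j\<in>J. real_character (X j)}) * ((real (card B))\<^sup>2 * V) \<le> 2 * ((real (card B))\<^sup>2 * V)"
      using real_card V0 unfolding J_def by (intro mult_right_mono) auto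
    then show ?thesis unfolding sumR by simp
  qed
  also have "\<dots> = (real q - 1) * card B * (T + 2 * card B * V / (real q - 1))"
    using q by (simp add: field_simps power2_eq_square)
  finally have "((real q - 1) * card B) * (card G * W / 2) \<le> ((real q - 1) * card B) * (T + 2 * card B * V / (real q - 1))"
    by (simp add: mult_ac)
  then have "card G * W / 2 \<le> T + 2 * card B * V / (real q - 1)"
    using q B0 by (subst (asm) mult_le_cancel_left_pos) auto
  then show False using T(2) unfolding V_def by simp
qed

section \<open>Choice of the resonator and of its parameters\<close>

text \<open>The pigeonhole argument runs with \<open>y = z ^ 8\<close>, \<open>i = j + 1\<close> and
  \<open>t = z ^ 16\<close>. \<open>growth\<close> is its hypothesis, \<open>small\<close> keeps the
  resonator below \<open>sqrt q\<close>, \<open>K\<close> brings the relevant range within reach of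
  \<open>density\<close>, and \<open>large\<close> makes the error from real characters
  negligible.\<close>

lemma exists_concentrated_character_sum:
  fixes c :: real and q z j :: nat and N :: int
  assumes q: "prime q" "q > 2" and N: "0 < N" "6 * N < int q"
    and c: "0 < c" and z: "z \<ge> 2"
    and density: "\<And>x. 1 \<le> x \<Longrightarrow> x \<le> real z ^ (8 + j) \<Longrightarrow>
      c * x \<le> real (card {a \<in> box_products (z ^ 8) (j + 1). real a \<le> x})"
    and growth: "((j + 1) * z ^ 16 + 1) ^ z ^ 8 < 2 ^ z ^ 16"
    and small: "real ((z ^ 8) ^ ((j + 1) * z ^ 16 * z ^ 8)) \<le> sqrt q"
    and K: "real q / (6 * of_int N) \<le> real z ^ (8 + j)"
    and large: "384 / c < sqrt q"
  shows "\<exists>chi. dirichlet_character q chi \<and> \<not> real_character chi \<and>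
    (c / 96)\<^sup>2 * real q * of_int N \<le> (\<Sum>x\<in>{int q - N..<int q}. (norm (interval_char_sum chi N x))\<^sup>2)"
proof -
  have sq: "sqrt (real q) * sqrt (real q) = real q" by simp
  have sq1: "sqrt (real q) > 1" using q by simp
  obtain B where B: "finite B" "B \<noteq> {}" "B \<subseteq> {1..(z ^ 8) ^ ((j + 1) * z ^ 16 * z ^ 8)}"
    and inv: "\<And>a. a \<in> box_products (z ^ 8) (j + 1) \<Longrightarrow> card B \<le> 2 * card {n \<in> B. a * n \<in> B}"
    using almost_invariant_set[OF growth] by blast
  have "card B \<le> card {1..(z ^ 8) ^ ((j + 1) * z ^ 16 * z ^ 8)}"
    using B(3) by (intro card_mono) auto
  then have "card B \<le> (z ^ 8) ^ ((j + 1) * z ^ 16 * z ^ 8)" by simp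
  then have cardB: "real (card B) \<le> sqrt q" using small by (meson of_nat_mono order_trans)
  have Bq: "B \<subseteq> {1..<q}"
  proof
    fix n assume "n \<in> B"
    then have n: "1 \<le> n" "n \<le> (z ^ 8) ^ ((j + 1) * z ^ 16 * z ^ 8)" using B(3) by auto
    have "real n \<le> sqrt q" using n(2) small by (meson of_nat_mono order_trans)
    also have "\<dots> < real q" using q by (intro real_less_lsqrt) (auto simp: power2_eq_square)
    finally show "n \<in> {1..<q}" using n(1) by simp
  qed
  \<comment> \<open>Up to this point \<open>norm_interval_exp_sum_ge\<close> applies;
    \<open>G\<close> collects the smooth numbers in that range.\<close>
  define x where "x = real q / (6 * of_int N)"
  define G where "G = {a \<in> box_products (z ^ 8) (j + 1). real a \<le> x}"
  have "real_of_int (6 * N) < real_of_int (int q)" using N(2) by (simp only: of_int_less_iff)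
  then have x1: "1 \<le> x" using N by (simp add: x_def field_simps)
  have cardG: "c * x \<le> real (card G)"
    unfolding G_def by (rule density[OF x1]) (use K in \<open>simp only: x_def\<close>)
  have G: "1 \<le> a" "6 * N * int a \<le> int q" if "a \<in> G" for a
  proof -
    show "1 \<le> a" using that box_products_pos by (auto simp: G_def Suc_le_eq)
    have "real a \<le> x" using that by (simp add: G_def)
    then have "real_of_int (6 * N * int a) \<le> real_of_int (int q)"
      using N by (simp add: x_def field_simps)
    then show "6 * N * int a \<le> int q" by (simp only: of_int_le_iff)
  qed
  have Gq: "G \<subseteq> {1..<q}"
  proof
    fix a assume a: "a \<in> G"
    have "1 * int a < 6 * N * int a" using G[OF a] N by (intro mult_strict_right_mono) auto
    also have "\<dots> \<le> int q" using G[OF a] by simp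
    finally show "a \<in> {1..<q}" using G[OF a] by simp
  qed
  let ?w = "\<lambda>a. (norm (interval_exp_sum q N a))\<^sup>2"
  have V: "(\<Sum>a\<in>{0..<int q}. ?w a) = real q * of_int N"
    using N by (intro sum_norm_interval_exp_sum) auto
  \<comment> \<open>Half of the main term: \<open>c * x * (N^2 / 4) / 2\<close> with
    \<open>x = q / (6 * N)\<close> equals \<open>c * q * N / 48\<close>. The other half absorbs the
    error, at most \<open>4 * sqrt q * N\<close>, exactly when \<open>sqrt q\<close> exceeds
    \<open>384 / c\<close>; this is what \<open>large\<close> says.\<close>
  define T where "T = c / 96 * (real q * of_int N)"
  have "T < card G * ((of_int N)\<^sup>2 / 4) / 2 - 2 * card B * (real q * of_int N) / (real q - 1)"
  proof -
    have 1: "c / 48 * (real q * of_int N) \<le> card G * ((of_int N)\<^sup>2 / 4) / 2"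
    proof -
      have "c / 48 * (real q * of_int N) = c * x * ((of_int N)\<^sup>2 / 4) / 2"
        using N by (simp add: x_def field_simps power2_eq_square)
      also have "\<dots> \<le> card G * ((of_int N)\<^sup>2 / 4) / 2"
        using cardG by (intro divide_right_mono mult_right_mono) auto
      finally show ?thesis .
    qed
    have 2: "2 * card B * (real q * of_int N) / (real q - 1) \<le> 4 * sqrt q * of_int N"
    proof -
      have "2 * card B * (real q * of_int N) / (real q - 1) = 2 * card B * of_int N * (real q / (real q - 1))"
        by simp
      also have "\<dots> \<le> 2 * sqrt q * of_int N * 2"
        using cardB N q by (intro mult_mono) (auto simp: field_simps)
      finally show ?thesis by simp
    qed
    have "384 < c * sqrt q" using large c by (simp add: field_simps)
    then have "384 * (sqrt q * of_int N) < c * sqrt q * (sqrt q * of_int N)"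
      using N sq1 by (intro mult_strict_right_mono) auto
    also have "\<dots> = c * (sqrt q * sqrt q * of_int N)" by (simp only: mult_ac)
    also have "\<dots> = c * (real q * of_int N)" by (simp only: sq)
    finally have 3: "4 * sqrt q * of_int N < c / 96 * (real q * of_int N)" by simp
    have "c / 48 * (real q * of_int N) = T + c / 96 * (real q * of_int N)"
      by (simp add: T_def)
    then show ?thesis using 1 2 3 by linarith
  qed
  then have T: "T < card G * ((of_int N)\<^sup>2 / 4) / 2 - 2 * card B * (\<Sum>a\<in>{0..<int q}. ?w a) / (real q - 1)"
    unfolding V .
  have "\<exists>chi. dirichlet_character q chi \<and> \<not> real_character chi \<and>
      T < norm (\<Sum>a\<in>{0..<int q}. cnj (chi a) * complex_of_real (?w a))"
  proof (rule resonance[OF q B(2) Bq Gq, where W = "(of_int N)\<^sup>2 / 4", OF _ _ _ _ _ T])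
    show "card B \<le> 2 * card {n \<in> B. a * n \<in> B}" if "a \<in> G" for a
      using that inv by (simp add: G_def)
    show "(of_int N)\<^sup>2 / 4 \<le> ?w (int a)" if "a \<in> G" for a
      using G[OF that] N q by (intro norm_interval_exp_sum_ge) auto
    show "0 \<le> T" using c N by (simp add: T_def)
  qed auto
  then obtain chi where chi: "dirichlet_character q chi" "\<not> real_character chi"
    and T: "T < norm (\<Sum>a\<in>{0..<int q}. cnj (chi a) * complex_of_real (?w a))" by blast
  let ?M = "\<Sum>x\<in>{int q - N..<int q}. (norm (interval_char_sum chi N x))\<^sup>2"
  have "T\<^sup>2 \<le> (norm (\<Sum>a\<in>{0..<int q}. cnj (chi a) * complex_of_real (?w a)))\<^sup>2"
    using T c N by (intro power_mono) (auto simp: T_def)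
  also have "\<dots> \<le> real q * of_int N * ?M"
    using N by (intro sum_norm_interval_char_sum_ge q chi) auto
  finally have "(real q * of_int N) * ((c / 96)\<^sup>2 * real q * of_int N) \<le> (real q * of_int N) * ?M"
    by (simp add: T_def power2_eq_square mult_ac)
  moreover have "real q * of_int N > 0" using N q by simp
  ultimately have "(c / 96)\<^sup>2 * real q * of_int N \<le> ?M" by (rule mult_left_le_imp_le)
  then show ?thesis using chi by blast
qed

text \<open>Takes \<open>z\<close> close to \<open>(ln q)^(1/64)\<close> and checks the size
  conditions of the previous lemma. The bound by \<open>2 * of_int N\<close> is recorded because the
  sums are normalised by \<open>H\<close> while the estimates involve its integer part.\<close>

lemma eventually_concentrated_character_sum:
  assumes A: "A > 0"
  shows "\<exists>c>0. \<forall>\<^sub>F q in primes_at_top. \<exists>chi N.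
    N = \<lfloor>real q / ln (real q) powr A\<rfloor> \<and> 0 < N \<and> N < int q \<and>
    real q / ln (real q) powr A \<le> 2 * of_int N \<and>
    dirichlet_character q chi \<and> \<not> real_character chi \<and>
    c * real q * of_int N \<le> (\<Sum>x\<in>{int q - N..<int q}. (norm (interval_char_sum chi N x))\<^sup>2)"
proof -
  \<comment> \<open>Since \<open>z\<close> will be at least \<open>(ln q)^(1/128)\<close>, this
    makes \<open>z ^ (8 + j)\<close> at least \<open>(ln q)^A\<close>.\<close>
  obtain j :: nat where j: "real j \<ge> 128 * A" using real_arch_simple by blast
  obtain c where c: "c > 0"
    and density: "\<And>z x. z \<ge> 2 \<Longrightarrow> 1 \<le> x \<Longrightarrow> x \<le> real z ^ (8 + j) \<Longrightarrow>
      c * x \<le> real (card {a \<in> box_products (z ^ 8) (j + 1). real a \<le> x})"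
    using box_products_density[of j] by blast
  \<comment> \<open>To be used with \<open>y = z ^ 8\<close>: raising the inequality to the power
    \<open>y\<close> turns the right side into \<open>2 ^ z ^ 16\<close>, as \<open>growth\<close>
    demands.\<close>
  have "eventually (\<lambda>y::nat. real (j + 1) * real y ^ 2 + 1 < 2 powr real y) at_top"
    by real_asymp
  then obtain y0 where y0: "\<And>y. y \<ge> y0 \<Longrightarrow> real (j + 1) * real y ^ 2 + 1 < 2 powr real y"
    by (auto simp: eventually_at_top_linorder)
  define L where "L = (\<lambda>q::nat. ln (real q))"
  have ev: "eventually (\<lambda>q. L q powr (1/64) \<ge> real y0 + 3) at_top"
    "eventually (\<lambda>q. L q powr (1/64) - 1 \<ge> L q powr (1/128)) at_top"
    "eventually (\<lambda>q. 2 * real (j + 1) \<le> L q powr (1/2)) at_top"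
    "eventually (\<lambda>q. L q \<ge> 1) at_top"
    "eventually (\<lambda>q. L q powr A > 6) at_top"
    "eventually (\<lambda>q. real q / L q powr A \<ge> 2) at_top"
    "eventually (\<lambda>q. 384 / c < sqrt (real q)) at_top"
    "eventually (\<lambda>q::nat. q > 2) at_top"
    unfolding L_def using A by real_asymp+
  have main: "eventually (\<lambda>q. prime q \<longrightarrow> (\<exists>chi N.
    N = \<lfloor>real q / ln (real q) powr A\<rfloor> \<and> 0 < N \<and> N < int q \<and>
    real q / ln (real q) powr A \<le> 2 * of_int N \<and>
    dirichlet_character q chi \<and> \<not> real_character chi \<and>
    (c / 96)\<^sup>2 * real q * of_int N \<le> (\<Sum>x\<in>{int q - N..<int q}. (norm (interval_char_sum chi N x))\<^sup>2))) at_top"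
    using ev
  proof eventually_elim
    case (elim q)
    show ?case
    proof
      assume prime: "prime q"
      define z where "z = nat \<lfloor>L q powr (1/64)\<rfloor>"
      define N where "N = \<lfloor>real q / L q powr A\<rfloor>"
      have "real z = of_int \<lfloor>L q powr (1/64)\<rfloor>" by (simp add: z_def)
      then have z_le: "real z \<le> L q powr (1/64)" and z_ge: "L q powr (1/64) - 1 \<le> real z"
        by linarith+
      have z2: "z \<ge> 2" and zy0: "z \<ge> y0" using z_ge elim(1) by linarith+
      have N0: "0 < N" and N2: "real q / L q powr A \<le> 2 * of_int N"
        unfolding N_def using elim(6) by linarith+
      have N6: "6 * N < int q"
      proof -
        have "6 * real_of_int N \<le> 6 * (real q / L q powr A)"
          unfolding N_def by (intro mult_left_mono) auto
        also have "\<dots> < real q"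
        proof -
          have "real q * 6 < real q * L q powr A"
            using elim(5,8) by (intro mult_strict_left_mono) auto
          moreover have "0 < L q powr A" using elim(5) by linarith
          ultimately show ?thesis by (simp add: pos_divide_less_eq mult.commute)
        qed
        finally show ?thesis by linarith
      qed
      have growth: "((j + 1) * z ^ 16 + 1) ^ z ^ 8 < 2 ^ z ^ 16"
      proof -
        have "y0 \<le> z ^ 8" using zy0 self_le_power[of z 8] z2 by linarith
        from y0[OF this] have "real (j + 1) * real (z ^ 8) ^ 2 + 1 < 2 ^ (z ^ 8)"
          by (simp add: powr_realpow del: of_nat_power)
        then have "real ((j + 1) * z ^ 16 + 1) < real (2 ^ (z ^ 8))"
          by (simp add: algebra_simps flip: power_mult)
        then have "(j + 1) * z ^ 16 + 1 < 2 ^ (z ^ 8)" by (simp only: of_nat_less_iff)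
        then have "((j + 1) * z ^ 16 + 1) ^ z ^ 8 < (2 ^ (z ^ 8)) ^ z ^ 8"
          using z2 by (intro power_strict_mono) auto
        also have "\<dots> = 2 ^ z ^ 16" by (simp flip: power_mult power_add)
        finally show ?thesis .
      qed
      \<comment> \<open>The logarithm of the left side is
        \<open>(j + 1) * z ^ 24 * ln (z ^ 8)\<close>, at most \<open>(j + 1) * z ^ 32\<close>. Here
        \<open>z ^ 32\<close> is at most \<open>sqrt (ln q)\<close> by the exponent
        \<open>1/64\<close>, and \<open>j + 1\<close> is at most half of that for large
        \<open>q\<close>.\<close>
      have small: "real ((z ^ 8) ^ ((j + 1) * z ^ 16 * z ^ 8)) \<le> sqrt q"
      proof -
        have "real z ^ 32 \<le> (L q powr (1/64)) ^ 32" using z_le by (intro power_mono) auto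
        also have "\<dots> = L q powr (1/2)" using elim(4) by (simp flip: powr_realpow add: powr_powr)
        finally have z32: "real z ^ 32 \<le> L q powr (1/2)" .
        have "ln (real ((z ^ 8) ^ ((j + 1) * z ^ 16 * z ^ 8)))
            = real ((j + 1) * z ^ 16 * z ^ 8) * ln (real z ^ 8)"
          using z2 by (simp add: ln_realpow)
        also have "real ((j + 1) * z ^ 16 * z ^ 8) = real (j + 1) * (real z ^ 16 * real z ^ 8)"
          by (simp only: of_nat_mult of_nat_power mult.assoc)
        also have "real z ^ 16 * real z ^ 8 = real z ^ 24" by (simp flip: power_add)
        also have "real (j + 1) * real z ^ 24 * ln (real z ^ 8)
            \<le> real (j + 1) * real z ^ 24 * real z ^ 8"
          using z2 ln_le_minus_one[of "real z ^ 8"] by (intro mult_left_mono) auto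
        also have "\<dots> = real (j + 1) * real z ^ 32" by (simp flip: power_add)
        also have "\<dots> \<le> (L q powr (1/2) / 2) * L q powr (1/2)"
          using elim(3) z32 by (intro mult_mono) auto
        also have "\<dots> = L q / 2" using elim(4) by (simp flip: powr_add)
        also have "\<dots> = ln (sqrt q)" using elim(8) by (simp add: L_def ln_sqrt)
        finally show ?thesis using z2 elim(8) by (subst (asm) ln_le_cancel_iff) auto
      qed
      have K: "real q / (6 * of_int N) \<le> real z ^ (8 + j)"
      proof -
        have "real q / (6 * of_int N) \<le> L q powr A / 3"
        proof -
          have "0 < L q powr A" using elim(5) by linarith
          then have "real q \<le> 2 * of_int N * L q powr A"
            using N2 by (simp only: pos_divide_le_eq)
          then show ?thesis using N0 by (simp add: field_simps)
        qed
        also have "\<dots> \<le> L q powr A" by simp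
        also have "\<dots> \<le> L q powr (1 / 128 * real (8 + j))"
          using j elim(4) by (intro powr_mono) auto
        also have "\<dots> = (L q powr (1/128)) ^ (8 + j)"
          using elim(4) by (subst powr_powr[symmetric], subst powr_realpow) auto
        also have "\<dots> \<le> real z ^ (8 + j)" using z_ge elim(2) by (intro power_mono) auto
        finally show ?thesis .
      qed
      have "\<exists>chi. dirichlet_character q chi \<and> \<not> real_character chi \<and>
          (c / 96)\<^sup>2 * real q * of_int N \<le> (\<Sum>x\<in>{int q - N..<int q}. (norm (interval_char_sum chi N x))\<^sup>2)"
        using exists_concentrated_character_sum[OF prime elim(8) N0 N6 c z2 density[OF z2] growth small K elim(7)] .
      moreover have "N = \<lfloor>real q / ln (real q) powr A\<rfloor>" by (simp only: N_def L_def)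
      moreover have "N < int q" using N0 N6 by linarith
      moreover have "real q / ln (real q) powr A \<le> 2 * of_int N" using N2 by (simp only: L_def)
      ultimately show "\<exists>chi N. N = \<lfloor>real q / ln (real q) powr A\<rfloor> \<and> 0 < N \<and> N < int q \<and>
          real q / ln (real q) powr A \<le> 2 * of_int N \<and>
          dirichlet_character q chi \<and> \<not> real_character chi \<and>
          (c / 96)\<^sup>2 * real q * of_int N \<le> (\<Sum>x\<in>{int q - N..<int q}. (norm (interval_char_sum chi N x))\<^sup>2)"
        using N0 by blast
    qed
  qed
  show ?thesis
    using main c by (intro exI[of _ "(c / 96)\<^sup>2"])
      (auto simp: primes_at_top_def eventually_inf_principal)
qed

section \<open>Comparison of truncated second moments\<close>

lemma prob_space_normal_half: "prob_space normal_half"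
  unfolding normal_half_def by (intro prob_space_normal_density) auto

lemma sets_normal_half [measurable_cong]: "sets normal_half = sets borel"
  by (simp add: normal_half_def)

lemma nn_integral_normal_half_square: "(\<integral>\<^sup>+x. ennreal (x\<^sup>2) \<partial>normal_half) = ennreal (1 / 2)"
proof -
  \<comment> \<open>The even moment formula with \<open>k = 1\<close>, where the quotient simplifies
    to the variance \<open>1/2\<close>.\<close>
  have "has_bochner_integral lborel (\<lambda>x. normal_density 0 (sqrt (1/2)) x * (x - 0) ^ (2 * 1))
      (fact (2 * 1) / ((2 / (sqrt (1/2))\<^sup>2) ^ 1 * fact 1))"
    by (rule normal_moment_even) simp
  moreover have "(sqrt (1/2 :: real))\<^sup>2 = 1 / 2" by (rule real_sqrt_pow2) simp
  ultimately have *: "has_bochner_integral lborel (\<lambda>x. normal_density 0 (sqrt (1/2)) x * x\<^sup>2) (1 / 2)"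
    by (simp add: fact_2 del: real_sqrt_divide)
  then have I: "integrable lborel (\<lambda>x. normal_density 0 (sqrt (1/2)) x * x\<^sup>2)"
    "(\<integral>x. normal_density 0 (sqrt (1/2)) x * x\<^sup>2 \<partial>lborel) = 1 / 2"
    by (simp_all only: has_bochner_integral_iff)
  have "(\<integral>\<^sup>+x. ennreal (x\<^sup>2) \<partial>normal_half) = (\<integral>\<^sup>+x. ennreal (normal_density 0 (sqrt (1/2)) x * x\<^sup>2) \<partial>lborel)"
    unfolding normal_half_def by (subst nn_integral_density) (auto simp: ennreal_mult)
  also have "\<dots> = ennreal (\<integral>x. normal_density 0 (sqrt (1/2)) x * x\<^sup>2 \<partial>lborel)"
    using I(1) by (intro nn_integral_eq_integral) auto
  finally show ?thesis unfolding I(2) .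
qed

lemma measurable_complex_of_pair [measurable]:
  "(\<lambda>(x, y). complex_of_real x + \<i> * complex_of_real y) \<in> borel_measurable (normal_half \<Otimes>\<^sub>M normal_half)"
  by measurable

text \<open>By Tonelli the two variances \<open>1/2\<close> add up. The value 1 equals the upper
  bound for the mean of \<open>|S|^2 / H\<close>, so any fixed loss under truncation contradicts
  convergence.\<close>

lemma nn_integral_complex_gaussian_square:
  "(\<integral>\<^sup>+z. ennreal ((norm z)\<^sup>2) \<partial>complex_gaussian) = 1"
proof -
  interpret N: prob_space normal_half by (rule prob_space_normal_half)
  have inner: "(\<integral>\<^sup>+y. ennreal (x\<^sup>2 + y\<^sup>2) \<partial>normal_half) = ennreal (x\<^sup>2) + ennreal (1 / 2)" for x
  proof -
    have "(\<integral>\<^sup>+y. ennreal (x\<^sup>2 + y\<^sup>2) \<partial>normal_half) = (\<integral>\<^sup>+y. ennreal (x\<^sup>2) + ennreal (y\<^sup>2) \<partial>normal_half)"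
      by simp
    also have "\<dots> = (\<integral>\<^sup>+y. ennreal (x\<^sup>2) \<partial>normal_half) + (\<integral>\<^sup>+y. ennreal (y\<^sup>2) \<partial>normal_half)"
      by (rule nn_integral_add) auto
    finally show ?thesis by (simp add: nn_integral_normal_half_square N.emeasure_space_1)
  qed
  have "(\<integral>\<^sup>+z. ennreal ((norm z)\<^sup>2) \<partial>complex_gaussian)
      = (\<integral>\<^sup>+p. ennreal ((fst p)\<^sup>2 + (snd p)\<^sup>2) \<partial>(normal_half \<Otimes>\<^sub>M normal_half))"
    unfolding complex_gaussian_def
    by (subst nn_integral_distr) (auto simp: cmod_def split_beta intro!: nn_integral_cong)
  also have "\<dots> = (\<integral>\<^sup>+x. \<integral>\<^sup>+y. ennreal (x\<^sup>2 + y\<^sup>2) \<partial>normal_half \<partial>normal_half)"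
    by (subst N.nn_integral_fst[symmetric]) auto
  also have "\<dots> = (\<integral>\<^sup>+x. ennreal (x\<^sup>2) \<partial>normal_half) + (\<integral>\<^sup>+x. ennreal (1 / 2) \<partial>normal_half)"
    unfolding inner by (rule nn_integral_add) auto
  also have "\<dots> = ennreal (1 / 2) + ennreal (1 / 2)"
    by (simp only: nn_integral_normal_half_square nn_integral_const N.emeasure_space_1 mult_1_right)
  also have "\<dots> = ennreal (1 / 2 + 1 / 2)" by (rule ennreal_plus[symmetric]) auto
  also have "\<dots> = 1" by simp
  finally show ?thesis .
qed

text \<open>Weak convergence tests only bounded functions, so the square is truncated; monotone
  truncations recover the full moment, dominated by \<open>|z|^2\<close> itself.\<close>

lemma truncated_second_moment_tendsto:
  "(\<lambda>k::nat. \<integral>z. min ((norm z)\<^sup>2) (real k) \<partial>complex_gaussian) \<longlonglongrightarrow> 1"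
proof -
  have sets [measurable_cong]: "sets complex_gaussian = sets borel"
    by (simp add: complex_gaussian_def)
  have int: "integrable complex_gaussian (\<lambda>z. (norm z)\<^sup>2)"
    by (rule integrableI_nn_integral_finite[where x = 1])
       (auto simp: nn_integral_complex_gaussian_square)
  have "(\<integral>z. (norm z)\<^sup>2 \<partial>complex_gaussian) = 1"
    by (subst integral_eq_nn_integral) (auto simp: nn_integral_complex_gaussian_square)
  moreover have "(\<lambda>k::nat. \<integral>z. min ((norm z)\<^sup>2) (real k) \<partial>complex_gaussian)
      \<longlonglongrightarrow> (\<integral>z. (norm z)\<^sup>2 \<partial>complex_gaussian)"
  proof (rule integral_dominated_convergence[where w = "\<lambda>z. (norm z)\<^sup>2"])
    show "AE z in complex_gaussian. (\<lambda>k. min ((norm z)\<^sup>2) (real k)) \<longlonglongrightarrow> (norm z)\<^sup>2"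
    proof (intro AE_I2 tendsto_eventually)
      fix z :: complex
      obtain k0 :: nat where "(norm z)\<^sup>2 \<le> real k0" using real_arch_simple by blast
      then have "min ((norm z)\<^sup>2) (real k) = (norm z)\<^sup>2" if "k \<ge> k0" for k
        using that by simp
      then show "eventually (\<lambda>k. min ((norm z)\<^sup>2) (real k) = (norm z)\<^sup>2) sequentially"
        by (auto simp: eventually_at_top_linorder)
    qed
  qed (use int in auto)
  ultimately show ?thesis by simp
qed

section \<open>Truncated second moments of the character sums\<close>

text \<open>On \<open>J\<close> the truncation level replaces the values of \<open>f\<close>,
  elsewhere \<open>f\<close> itself is the bound: a large mass on a small set is lost.\<close>

lemma truncated_average_le:
  fixes f :: "'a \<Rightarrow> real"
  assumes "finite R" "J \<subseteq> R" "\<And>x. 0 \<le> f x"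
  shows "(\<Sum>x\<in>R. min (f x) b) \<le> (\<Sum>x\<in>R. f x) - (\<Sum>x\<in>J. f x) + real (card J) * b"
proof -
  have "(\<Sum>x\<in>R. min (f x) b) = (\<Sum>x\<in>R - J. min (f x) b) + (\<Sum>x\<in>J. min (f x) b)"
    using assms by (intro sum.subset_diff)
  also have "\<dots> \<le> (\<Sum>x\<in>R - J. f x) + (\<Sum>x\<in>J. b)"
    by (intro add_mono sum_mono) auto
  also have "(\<Sum>x\<in>R - J. f x) = (\<Sum>x\<in>R. f x) - (\<Sum>x\<in>J. f x)"
    using assms by (intro sum_diff)
  finally show ?thesis by simp
qed

text \<open>The full second moment is at most 1. The last \<open>N\<close> points carry at least
  \<open>c / 2\<close> of it, the factor \<open>1/2\<close> coming from normalising by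
  \<open>H\<close> instead of \<open>N\<close>, and after truncation they contribute at most
  \<open>b\<close> times their probability.\<close>

lemma truncated_second_moment_le:
  fixes chi :: "int \<Rightarrow> complex" and q :: nat and H c b :: real and N :: int
  assumes q: "prime q" and chi: "dirichlet_character q chi" "\<not> real_character chi"
    and N: "N = \<lfloor>H\<rfloor>" "0 < N" "N < int q" "H \<le> 2 * of_int N"
    and c: "c \<ge> 0" "c * real q * of_int N \<le> (\<Sum>x\<in>{int q - N..<int q}. (norm (interval_char_sum chi N x))\<^sup>2)"
    and b: "0 \<le> b"
  shows "(\<integral>z. min ((norm z)\<^sup>2) b \<partial>distr (measure_pmf (pmf_of_set {0..int q - 1})) borel
      (\<lambda>x. short_char_sum chi H x / complex_of_real (sqrt H))) \<le> 1 - c / 2 + H / real q * b"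
proof -
  define R where "R = {0..<int q}"
  define J where "J = {int q - N..<int q}"
  define f where "f = (\<lambda>x. (norm (interval_char_sum chi N x))\<^sup>2 / H)"
  have q0: "q > 0" using N by simp
  have NH: "of_int N \<le> H" using N(1) by simp
  then have H0: "H > 0" using N(2) by linarith
  have R_eq: "{0..int q - 1} = R" unfolding R_def by auto
  have R: "finite R" "R \<noteq> {}" "card R = q" using q0 by (auto simp: R_def)
  have f: "(norm (short_char_sum chi H x / complex_of_real (sqrt H)))\<^sup>2 = f x" for x
    using H0 N(1) by (simp add: f_def short_char_sum_eq norm_divide power_divide)
  have f0: "0 \<le> f x" for x using H0 by (simp add: f_def)
  have "(\<integral>z. min ((norm z)\<^sup>2) b \<partial>distr (measure_pmf (pmf_of_set R)) borel
      (\<lambda>x. short_char_sum chi H x / complex_of_real (sqrt H)))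
      = (\<integral>x. min (f x) b \<partial>measure_pmf (pmf_of_set R))"
    by (subst integral_distr) (auto simp: f)
  also have "\<dots> = (\<Sum>x\<in>R. min (f x) b) / real q"
    using R by (simp add: integral_pmf_of_set)
  also have "\<dots> \<le> (real q - c / 2 * real q + H * b) / real q"
  proof (intro divide_right_mono)
    have "(\<Sum>x\<in>R. min (f x) b) \<le> (\<Sum>x\<in>R. f x) - (\<Sum>x\<in>J. f x) + real (card J) * b"
      using R(1) f0 N by (intro truncated_average_le) (auto simp: J_def R_def)
    also have "\<dots> \<le> real q - c / 2 * real q + H * b"
    proof -
      have "(\<Sum>x\<in>R. f x) = (\<Sum>x\<in>R. (norm (interval_char_sum chi N x))\<^sup>2) / H"
        by (simp add: f_def sum_divide_distrib)
      also have "\<dots> \<le> (real q * of_int N) / H"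
        unfolding R_def using H0 N
        by (intro divide_right_mono sum_norm_interval_char_sum_le q chi) auto
      also have "\<dots> \<le> (real q * H) / H"
        using NH H0 by (intro divide_right_mono mult_left_mono) auto
      finally have 1: "(\<Sum>x\<in>R. f x) \<le> real q" using H0 by simp
      have "c / 2 * real q = c * real q * (H / 2) / H" using H0 by simp
      also have "\<dots> \<le> c * real q * of_int N / H"
        using N(4) c(1) H0 by (intro divide_right_mono mult_left_mono) auto
      also have "\<dots> \<le> (\<Sum>x\<in>J. (norm (interval_char_sum chi N x))\<^sup>2) / H"
        unfolding J_def using c(2) H0 by (intro divide_right_mono) auto
      also have "\<dots> = (\<Sum>x\<in>J. f x)" by (simp add: f_def sum_divide_distrib)
      finally have 2: "c / 2 * real q \<le> (\<Sum>x\<in>J. f x)" .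
      have 3: "real (card J) * b \<le> H * b"
        using NH N(2) b by (intro mult_right_mono) (auto simp: J_def)
      show ?thesis using 1 2 3 by linarith
    qed
    finally show "(\<Sum>x\<in>R. min (f x) b) \<le> real q - c / 2 * real q + H * b" .
  qed simp
  also have "\<dots> = 1 - c / 2 + H / real q * b"
    using q0 by (simp add: field_simps)
  finally show ?thesis unfolding R_eq .
qed

theorem theorem2:
  fixes A :: real and H :: "nat \<Rightarrow> real"
  assumes "A > 0"
    and "\<And>q. H q = real q / ln (real q) powr A"
  shows "\<exists>chi :: nat \<Rightarrow> int \<Rightarrow> complex.
    (\<forall>\<^sub>F q in primes_at_top. dirichlet_character q (chi q) \<and> \<not> real_character (chi q)) \<and>
    \<not> weak_conv_on
        (\<lambda>q. distr (measure_pmf (pmf_of_set {0..int q - 1})) borel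
               (\<lambda>x. short_char_sum (chi q) (H q) x / complex_of_real (sqrt (H q))))
        complex_gaussian primes_at_top"
proof -
  define good where "good = (\<lambda>c q chi N. N = \<lfloor>H q\<rfloor> \<and> 0 < N \<and> N < int q \<and> H q \<le> 2 * of_int N \<and>
    dirichlet_character q chi \<and> \<not> real_character chi \<and>
    c * real q * of_int N \<le> (\<Sum>x\<in>{int q - N..<int q}. (norm (interval_char_sum chi N x))\<^sup>2))"
  obtain c where c: "c > 0" and ev: "\<forall>\<^sub>F q in primes_at_top. \<exists>chi N. good c q chi N"
    using eventually_concentrated_character_sum[OF assms(1)] unfolding good_def assms(2) by blast
  \<comment> \<open>Where no suitable character exists the value is unspecified; this happens for no
    large prime.\<close>
  define chi where "chi = (\<lambda>q. SOME chi. \<exists>N. good c q chi N)"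
  have chi: "\<forall>\<^sub>F q in primes_at_top. \<exists>N. good c q (chi q) N"
    using ev
  proof eventually_elim
    case (elim q)
    then show ?case unfolding chi_def by (rule someI_ex)
  qed
  let ?\<mu> = "\<lambda>q. distr (measure_pmf (pmf_of_set {0..int q - 1})) borel
     (\<lambda>x. short_char_sum (chi q) (H q) x / complex_of_real (sqrt (H q)))"
  have "\<forall>\<^sub>F q in primes_at_top. dirichlet_character q (chi q) \<and> \<not> real_character (chi q)"
    using chi by eventually_elim (auto simp: good_def)
  moreover have "\<not> weak_conv_on ?\<mu> complex_gaussian primes_at_top"
  proof
    assume conv: "weak_conv_on ?\<mu> complex_gaussian primes_at_top"
    \<comment> \<open>The truncation level \<open>k\<close> is fixed here, before \<open>q\<close>
      grows, so that the term \<open>H q / q * k\<close> tends to 0.\<close>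
    have "\<forall>\<^sub>F k::nat in sequentially. 1 - c / 2 < (\<integral>z. min ((norm z)\<^sup>2) (real k) \<partial>complex_gaussian)"
      using truncated_second_moment_tendsto c by (intro order_tendstoD) auto
    then obtain k :: nat where k: "1 - c / 2 < (\<integral>z. min ((norm z)\<^sup>2) (real k) \<partial>complex_gaussian)"
      by (auto simp: eventually_at_top_linorder)
    have "continuous_on UNIV (\<lambda>z::complex. min ((norm z)\<^sup>2) (real k))"
      by (intro continuous_intros)
    moreover have "bounded (range (\<lambda>z::complex. min ((norm z)\<^sup>2) (real k)))"
      by (rule boundedI[of _ "real k"]) auto
    ultimately have lim: "((\<lambda>q. \<integral>z. min ((norm z)\<^sup>2) (real k) \<partial>?\<mu> q)
        \<longlongrightarrow> (\<integral>z. min ((norm z)\<^sup>2) (real k) \<partial>complex_gaussian)) primes_at_top"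
      using conv unfolding weak_conv_on_def by blast
    have le: "\<forall>\<^sub>F q in primes_at_top. (\<integral>z. min ((norm z)\<^sup>2) (real k) \<partial>?\<mu> q) \<le> 1 - c / 2 + H q / real q * real k"
    proof -
      have "\<forall>\<^sub>F q in primes_at_top. prime q"
        by (simp add: primes_at_top_def eventually_inf_principal)
      with chi show ?thesis
      proof eventually_elim
        case (elim q)
        then obtain N where "good c q (chi q) N" by blast
        then show ?case
          using c elim(2) unfolding good_def by (intro truncated_second_moment_le) auto
      qed
    qed
    have "((\<lambda>q. H q / real q) \<longlongrightarrow> 0) at_top"
    proof (rule Lim_transform_eventually)
      show "((\<lambda>q. 1 / ln (real q) powr A) \<longlongrightarrow> 0) at_top"
        using assms(1) by real_asymp
      show "\<forall>\<^sub>F q in at_top. 1 / ln (real q) powr A = H q / real q"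
        using eventually_gt_at_top[of 0] by eventually_elim (simp add: assms(2))
    qed
    then have "((\<lambda>q. H q / real q) \<longlongrightarrow> 0) primes_at_top"
      by (rule tendsto_mono[rotated]) (simp add: primes_at_top_def)
    then have "((\<lambda>q. 1 - c / 2 + H q / real q * real k) \<longlongrightarrow> 1 - c / 2 + 0 * real k) primes_at_top"
      by (intro tendsto_intros)
    \<comment> \<open>In the limit the truncated Gaussian moment would be at most
      \<open>1 - c / 2\<close>, against the choice of \<open>k\<close>. Comparing limits requires a
      nontrivial filter, that is, infinitely many primes.\<close>
    from tendsto_le[OF primes_at_top_neq_bot this lim le] k show False by simp
  qed
  ultimately show ?thesis by blast
qed

end
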